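(* Let $k$ be a field and let $E$ be a finite quiver. Then the Leavitt path algebra $L(E)$ is flat as a right $P(\overline{E})$-module.
   Context: $E=(E^0,E^1,r,s)$ is a finite quiver with source and range maps $s,r$. The inverse quiver $\overline{E}$ has the same vertices and, for each $e\in E^1$, an arrow $\overline{e}$ with $s(\overline e)=r(e)$, $r(\overline e)=s(e)$. The path algebra $P(\overline E)$ over $k$ has basis the set of all paths in $\overline E$ (sequences of arrows $f_1\cdots f_n$ with $r(f_t)=s(f_{t+1})$, and trivial paths $p_i$, $i\in E^0$), with product given by concatenation (zero if not composable). The Leavitt path algebra $L(E)=L_k(E)$ is the $k$-algebra generated by $\{p_v: v\in E^0\}\cup\{e,\overline e: e\in E^1\}$ subject to: $p_vp_{v'}=\delta_{v,v'}p_v$ (with $\sum_v p_v=1$); $p_{s(e)}e=ep_{r(e)}=e$; $p_{r(e)}\overline e=\overline e p_{s(e)}=\overline e$; $\overline e e'=\delta_{e,e'}p_{r(e)}$; and $p_v=\sum_{s(e)=v}e\overline e$ for every $v\in E^0$ that emits arrows. $P(\overline E)$ is regarded as the subalgebra of $L(E)$ generated by the $p_v$ and the $\overline e$, and this makes $L(E)$ a right $P(\overline E)$-module. *)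

theory Defs
  imports "HOL-Algebra.QuotRing" "HOL-Algebra.Module" "HOL-Algebra.Generated_Groups"
    "HOL-Algebra.Free_Abelian_Groups" "Graph_Theory.Arc_Walk"
begin

section \<open>Modules over a not necessarily commutative ring\<close>

text \<open>
  The library locale \<open>module\<close> requires a commutative ring. Only its record type is reused;
  the \<open>mult\<close> and \<open>one\<close> fields of a module record are never looked at.
\<close>

locale left_module = R?: ring R + M?: abelian_group M
  for R :: "('r, 'a) ring_scheme" (structure) and M :: "('r, 'm, 'b) module_scheme" (structure) +
  assumes smult_closed:
      "\<lbrakk>a \<in> carrier R; x \<in> carrier M\<rbrakk> \<Longrightarrow> a \<odot>\<^bsub>M\<^esub> x \<in> carrier M"
    and smult_l_distr:
      "\<lbrakk>a \<in> carrier R; b \<in> carrier R; x \<in> carrier M\<rbrakk> \<Longrightarrow>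
       (a \<oplus>\<^bsub>R\<^esub> b) \<odot>\<^bsub>M\<^esub> x = a \<odot>\<^bsub>M\<^esub> x \<oplus>\<^bsub>M\<^esub> b \<odot>\<^bsub>M\<^esub> x"
    and smult_r_distr:
      "\<lbrakk>a \<in> carrier R; x \<in> carrier M; y \<in> carrier M\<rbrakk> \<Longrightarrow>
       a \<odot>\<^bsub>M\<^esub> (x \<oplus>\<^bsub>M\<^esub> y) = a \<odot>\<^bsub>M\<^esub> x \<oplus>\<^bsub>M\<^esub> a \<odot>\<^bsub>M\<^esub> y"
    and smult_assoc:
      "\<lbrakk>a \<in> carrier R; b \<in> carrier R; x \<in> carrier M\<rbrakk> \<Longrightarrow>
       (a \<otimes>\<^bsub>R\<^esub> b) \<odot>\<^bsub>M\<^esub> x = a \<odot>\<^bsub>M\<^esub> (b \<odot>\<^bsub>M\<^esub> x)"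
    and smult_one: "x \<in> carrier M \<Longrightarrow> \<one>\<^bsub>R\<^esub> \<odot>\<^bsub>M\<^esub> x = x"

text \<open>In a right module, \<open>a \<odot> x\<close> stands for the element usually written \<open>x a\<close>.\<close>

locale right_module = R?: ring R + M?: abelian_group M
  for R :: "('r, 'a) ring_scheme" (structure) and M :: "('r, 'm, 'b) module_scheme" (structure) +
  assumes smult_closed:
      "\<lbrakk>a \<in> carrier R; x \<in> carrier M\<rbrakk> \<Longrightarrow> a \<odot>\<^bsub>M\<^esub> x \<in> carrier M"
    and smult_l_distr:
      "\<lbrakk>a \<in> carrier R; b \<in> carrier R; x \<in> carrier M\<rbrakk> \<Longrightarrow>
       (a \<oplus>\<^bsub>R\<^esub> b) \<odot>\<^bsub>M\<^esub> x = a \<odot>\<^bsub>M\<^esub> x \<oplus>\<^bsub>M\<^esub> b \<odot>\<^bsub>M\<^esub> x"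
    and smult_r_distr:
      "\<lbrakk>a \<in> carrier R; x \<in> carrier M; y \<in> carrier M\<rbrakk> \<Longrightarrow>
       a \<odot>\<^bsub>M\<^esub> (x \<oplus>\<^bsub>M\<^esub> y) = a \<odot>\<^bsub>M\<^esub> x \<oplus>\<^bsub>M\<^esub> a \<odot>\<^bsub>M\<^esub> y"
    and smult_assoc:
      "\<lbrakk>a \<in> carrier R; b \<in> carrier R; x \<in> carrier M\<rbrakk> \<Longrightarrow>
       (a \<otimes>\<^bsub>R\<^esub> b) \<odot>\<^bsub>M\<^esub> x = b \<odot>\<^bsub>M\<^esub> (a \<odot>\<^bsub>M\<^esub> x)"
    and smult_one: "x \<in> carrier M \<Longrightarrow> \<one>\<^bsub>R\<^esub> \<odot>\<^bsub>M\<^esub> x = x"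

definition left_module_hom ::
  "('r, 'a) ring_scheme \<Rightarrow> ('r, 'm, 'b) module_scheme \<Rightarrow> ('r, 'n, 'c) module_scheme \<Rightarrow> ('m \<Rightarrow> 'n) set"
  where "left_module_hom R M N =
    {f \<in> hom (add_monoid M) (add_monoid N).
       \<forall>a\<in>carrier R. \<forall>x\<in>carrier M. f (a \<odot>\<^bsub>M\<^esub> x) = a \<odot>\<^bsub>N\<^esub> f x}"


section \<open>Tensor products and flatness\<close>

definition tensor_relations ::
  "('r, 'a) ring_scheme \<Rightarrow> ('r, 'l, 'b) module_scheme \<Rightarrow> ('r, 'm, 'c) module_scheme
    \<Rightarrow> ('l \<times> 'm \<Rightarrow>\<^sub>0 int) set"
  where "tensor_relations R L M =
    {frag_of (x \<oplus>\<^bsub>L\<^esub> y, m) - frag_of (x, m) - frag_of (y, m) | x y m.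
       x \<in> carrier L \<and> y \<in> carrier L \<and> m \<in> carrier M} \<union>
    {frag_of (x, m \<oplus>\<^bsub>M\<^esub> n) - frag_of (x, m) - frag_of (x, n) | x m n.
       x \<in> carrier L \<and> m \<in> carrier M \<and> n \<in> carrier M} \<union>
    {frag_of (a \<odot>\<^bsub>L\<^esub> x, m) - frag_of (x, a \<odot>\<^bsub>M\<^esub> m) | a x m.
       a \<in> carrier R \<and> x \<in> carrier L \<and> m \<in> carrier M}"

definition tensor_kernel ::
  "('r, 'a) ring_scheme \<Rightarrow> ('r, 'l, 'b) module_scheme \<Rightarrow> ('r, 'm, 'c) module_scheme
    \<Rightarrow> ('l \<times> 'm \<Rightarrow>\<^sub>0 int) set"
  where "tensor_kernel R L M =
    generate (free_Abelian_group (carrier L \<times> carrier M)) (tensor_relations R L M)"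

definition tensor_product ::
  "('r, 'a) ring_scheme \<Rightarrow> ('r, 'l, 'b) module_scheme \<Rightarrow> ('r, 'm, 'c) module_scheme
    \<Rightarrow> ('l \<times> 'm \<Rightarrow>\<^sub>0 int) set monoid"
  where "tensor_product R L M =
    free_Abelian_group (carrier L \<times> carrier M) Mod tensor_kernel R L M"

text \<open>
  The homomorphism of abelian groups \<open>L \<otimes>\<^sub>R M \<rightarrow> L \<otimes>\<^sub>R N\<close> sending \<open>x \<otimes> m\<close> to \<open>x \<otimes> f m\<close>.
  It is read off from representatives \<open>c\<close> of the coset \<open>C\<close>; the coset obtained does not depend
  on the choice of \<open>c\<close> if \<open>f\<close> is a homomorphism of left modules.
\<close>

definition tensor_map ::
  "('r, 'a) ring_scheme \<Rightarrow> ('r, 'l, 'b) module_scheme \<Rightarrow> ('r, 'n, 'd) module_scheme \<Rightarrow> ('m \<Rightarrow> 'n)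
    \<Rightarrow> ('l \<times> 'm \<Rightarrow>\<^sub>0 int) set \<Rightarrow> ('l \<times> 'n \<Rightarrow>\<^sub>0 int) set"
  where "tensor_map R L N f C = the_elem
    ((\<lambda>c. tensor_kernel R L N #>\<^bsub>free_Abelian_group (carrier L \<times> carrier N)\<^esub>
            frag_extend (\<lambda>(x, m). frag_of (x, f m)) c) ` C)"

text \<open>
  Flatness means that tensoring with \<open>L\<close> preserves injectivity of homomorphisms of left modules. A
  definition cannot quantify over types, so the types of the elements of \<open>M\<close> and \<open>N\<close> are parameters; leaving them
  as type variables in a theorem makes it range over all left modules.
\<close>

definition flat_right_module ::
  "'m itself \<Rightarrow> 'n itself \<Rightarrow> ('r, 'a) ring_scheme \<Rightarrow> ('r, 'l, 'b) module_scheme \<Rightarrow> bool"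
  where "flat_right_module _ _ R L \<longleftrightarrow>
    right_module R L \<and>
    (\<forall>(M :: ('r, 'm) module) (N :: ('r, 'n) module) f.
       left_module R M \<longrightarrow> left_module R N \<longrightarrow>
       f \<in> left_module_hom R M N \<longrightarrow> inj_on f (carrier M) \<longrightarrow>
       inj_on (tensor_map R L N f) (carrier (tensor_product R L M)))"


section \<open>Path algebras\<close>

definition inverse_quiver :: "('v, 'e) pre_digraph \<Rightarrow> ('v, 'e) pre_digraph"
  where "inverse_quiver E = \<lparr>verts = verts E, arcs = arcs E, tail = head E, head = tail E\<rparr>"

text \<open>
  A path is given by its source and its list of arrows; \<open>(v, [])\<close> is the trivial path at \<open>v\<close>.
\<close>

type_synonym ('v, 'e) path = "'v \<times> 'e list"

definition paths :: "('v, 'e) pre_digraph \<Rightarrow> ('v, 'e) path set"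
  where "paths G = {(u, p). \<exists>v. pre_digraph.awalk G u p v}"

definition path_target :: "('v, 'e) pre_digraph \<Rightarrow> ('v, 'e) path \<Rightarrow> 'v"
  where "path_target G x = last (pre_digraph.awalk_verts G (fst x) (snd x))"

definition path_algebra :: "('v, 'e) pre_digraph \<Rightarrow> (('v, 'e) path \<Rightarrow>\<^sub>0 'k::field) ring"
  where "path_algebra G =
    \<lparr>carrier = {f. Poly_Mapping.keys f \<subseteq> paths G},
     monoid.mult = (\<lambda>f g. \<Sum>x\<in>Poly_Mapping.keys f. \<Sum>y\<in>Poly_Mapping.keys g.
       (if path_target G x = fst y
        then Poly_Mapping.single (fst x, snd x @ snd y)
               (Poly_Mapping.lookup f x * Poly_Mapping.lookup g y)
        else 0)),
     one = (\<Sum>v\<in>verts G. Poly_Mapping.single (v, []) 1),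
     ring.zero = 0,
     ring.add = (+)\<rparr>"


section \<open>Leavitt path algebras\<close>

text \<open>The free unital associative algebra on \<open>G\<close>; its basis consists of the words in \<open>G\<close>.\<close>

definition free_algebra :: "'g set \<Rightarrow> ('g list \<Rightarrow>\<^sub>0 'k::field) ring"
  where "free_algebra G =
    \<lparr>carrier = {f. Poly_Mapping.keys f \<subseteq> lists G},
     monoid.mult = (\<lambda>f g. \<Sum>u\<in>Poly_Mapping.keys f. \<Sum>w\<in>Poly_Mapping.keys g.
       Poly_Mapping.single (u @ w) (Poly_Mapping.lookup f u * Poly_Mapping.lookup g w)),
     one = Poly_Mapping.single [] 1,
     ring.zero = 0,
     ring.add = (+)\<rparr>"

datatype ('v, 'e) leavitt_gen = Vertex 'v | Arrow 'e | Ghost 'e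

definition leavitt_gens :: "('v, 'e) pre_digraph \<Rightarrow> ('v, 'e) leavitt_gen set"
  where "leavitt_gens E = Vertex ` verts E \<union> Arrow ` arcs E \<union> Ghost ` arcs E"

definition leavitt_relations ::
  "('v, 'e) pre_digraph \<Rightarrow> (('v, 'e) leavitt_gen list \<Rightarrow>\<^sub>0 'k::field) set"
  where "leavitt_relations E = (let W = (\<lambda>w. Poly_Mapping.single w 1) in
    {W [Vertex v, Vertex v'] - (if v = v' then W [Vertex v] else 0) | v v'.
       v \<in> verts E \<and> v' \<in> verts E} \<union>
    {(\<Sum>v\<in>verts E. W [Vertex v]) - W []} \<union>
    {W [Vertex (tail E e), Arrow e] - W [Arrow e] | e. e \<in> arcs E} \<union>
    {W [Arrow e, Vertex (head E e)] - W [Arrow e] | e. e \<in> arcs E} \<union>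
    {W [Vertex (head E e), Ghost e] - W [Ghost e] | e. e \<in> arcs E} \<union>
    {W [Ghost e, Vertex (tail E e)] - W [Ghost e] | e. e \<in> arcs E} \<union>
    {W [Ghost e, Arrow e'] - (if e = e' then W [Vertex (head E e)] else 0) | e e'.
       e \<in> arcs E \<and> e' \<in> arcs E} \<union>
    {W [Vertex v] - (\<Sum>e\<in>out_arcs E v. W [Arrow e, Ghost e]) | v.
       v \<in> verts E \<and> out_arcs E v \<noteq> {}})"

definition leavitt_ideal ::
  "('v, 'e) pre_digraph \<Rightarrow> (('v, 'e) leavitt_gen list \<Rightarrow>\<^sub>0 'k::field) set"
  where "leavitt_ideal E = Idl\<^bsub>free_algebra (leavitt_gens E)\<^esub> (leavitt_relations E)"

definition leavitt_path_algebra ::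
  "('v, 'e) pre_digraph \<Rightarrow> (('v, 'e) leavitt_gen list \<Rightarrow>\<^sub>0 'k::field) set ring"
  where "leavitt_path_algebra E = free_algebra (leavitt_gens E) Quot leavitt_ideal E"

text \<open>
  The canonical map from the path algebra of the inverse quiver to the Leavitt path algebra. The
  path with source \<open>u\<close> and arrows \<open>e\<^sub>1, \<dots>, e\<^sub>n\<close> of the inverse quiver is sent to the class of the
  word \<open>p\<^sub>u e\<^sub>1 \<dots> e\<^sub>n\<close> in ghost arrows; the leading \<open>p\<^sub>u\<close> is redundant in the quotient unless
  \<open>n = 0\<close>.
\<close>

definition path_word :: "('v, 'e) path \<Rightarrow> ('v, 'e) leavitt_gen list"
  where "path_word x = Vertex (fst x) # map Ghost (snd x)"

definition ghost_embedding ::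
  "('v, 'e) pre_digraph \<Rightarrow> (('v, 'e) path \<Rightarrow>\<^sub>0 'k::field)
    \<Rightarrow> (('v, 'e) leavitt_gen list \<Rightarrow>\<^sub>0 'k) set"
  where "ghost_embedding E f =
    leavitt_ideal E +>\<^bsub>free_algebra (leavitt_gens E)\<^esub>
      (\<Sum>x\<in>Poly_Mapping.keys f. Poly_Mapping.single (path_word x) (Poly_Mapping.lookup f x))"

definition leavitt_right_module ::
  "('v, 'e) pre_digraph
    \<Rightarrow> (('v, 'e) path \<Rightarrow>\<^sub>0 'k::field, (('v, 'e) leavitt_gen list \<Rightarrow>\<^sub>0 'k) set) module"
  where "leavitt_right_module E = ring.extend (leavitt_path_algebra E)
    \<lparr>smult = (\<lambda>a x. x \<otimes>\<^bsub>leavitt_path_algebra E\<^esub> ghost_embedding E a)\<rparr>"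

end

theory Submission
  imports Defs
begin

text \<open>
  Since \<open>p\<^sub>v = \<Sum> e \<bar>e\<close> for a vertex \<open>v\<close> that is not a sink, \<open>1 = \<Sum> \<gamma> \<gamma>\<^sup>*\<close> in \<open>L(E)\<close> for every \<open>n\<close>, where
  \<open>\<gamma>\<close> ranges over the paths of length \<open>n\<close> and the shorter paths that end at a sink, and \<open>\<gamma>\<^sup>*\<close> is the
  reversed path in the ghost arrows. For fixed \<open>x\<close> and large \<open>n\<close> all the elements \<open>\<gamma>\<^sup>* x\<close> lie in
  \<open>P(\<bar>E)\<close>, so \<open>x = \<Sum> \<gamma> (\<gamma>\<^sup>* x)\<close> expands \<open>x\<close> in the elements \<open>\<gamma>\<close> with coefficients in \<open>P(\<bar>E)\<close>:
  \<open>L(E)\<close> is a directed union of finitely generated projective modules. That \<open>\<gamma>\<^sup>* x\<close> is well defined as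
  an element of \<open>P(\<bar>E)\<close> for large \<open>n\<close> is read off from the action of the generators of \<open>L(E)\<close> on the
  ghost paths.
\<close>

section \<open>A flatness criterion\<close>

text \<open>The ghost paths do not span a right L(E)-module under the obvious rules: p_v e is not a
  ghost path, and giving it the value 0 contradicts p_v = \<Sum> e \<bar>e unless v is a sink. The
  relations act correctly only on ghost paths that still have an arrow to give up or whose source is
  a sink of E. An element of the Leavitt ideal therefore kills the ghost paths beyond some depth,
  and this depth depends on the element. For the same reason the coordinates \<gamma>^* x are
  additive and linear in x only for large n, with a bound that depends on the arguments. This is why
  flatness is derived from laws that hold eventually along a filter. The filter takes the place of a
  direct limit of projective modules and of its tensor product: a tensor is a formal sum, which
  involves finitely many elements, so that finitely many of these bounds have to be met.\<close>

lemma (in abelian_group) add_minus_minus: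
  assumes "x \<in> carrier G" "y \<in> carrier G"
  shows "x \<oplus> y \<ominus> x \<ominus> y = \<zero>"
  using assms by (simp add: minus_eq a_comm[of x y] a_assoc r_neg)

section \<open>Formal sums that represent zero in a tensor product\<close>

locale tensor_factors = L: right_module R L + M: left_module R M
  for R :: "('r, 'a) ring_scheme"
    and L :: "('r, 'l, 'b) module_scheme" and M :: "('r, 'm, 'c) module_scheme"
begin

lemma tensor_relations_subset:
  "tensor_relations R L M \<subseteq> carrier (free_Abelian_group (carrier L \<times> carrier M))"
proof -
  have 1: "frag_of a - frag_of b \<in> carrier (free_Abelian_group S)"
    if "a \<in> S" "b \<in> S" for a b :: "'l \<times> 'm" and S
    using that keys_diff[of "frag_of a" "frag_of b"] by auto
  have 2: "frag_of a - frag_of b - frag_of c \<in> carrier (free_Abelian_group S)"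
    if "a \<in> S" "b \<in> S" "c \<in> S" for a b c :: "'l \<times> 'm" and S
    using 1[OF that(1,2)] that(3) keys_diff[of "frag_of a - frag_of b" "frag_of c"] by auto
  show ?thesis
    unfolding tensor_relations_def
    by (intro Un_least subsetI; elim CollectE exE conjE; hypsubst; intro 1 2)
      (simp_all add: L.smult_closed M.smult_closed)
qed

lemma subgroup_tensor_kernel:
  "subgroup (tensor_kernel R L M) (free_Abelian_group (carrier L \<times> carrier M))"
  unfolding tensor_kernel_def
  by (rule group.generate_is_subgroup[OF group_free_Abelian_group tensor_relations_subset])

lemma keys_tensor_kernel:
  "c \<in> tensor_kernel R L M \<Longrightarrow> Poly_Mapping.keys c \<subseteq> carrier L \<times> carrier M"
  using subsetD[OF subgroup.subset[OF subgroup_tensor_kernel], of c]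
  by (simp only: carrier_free_Abelian_group_iff)

lemma tensor_kernel_zero: "0 \<in> tensor_kernel R L M"
  using subgroup.one_closed[OF subgroup_tensor_kernel] by simp

lemma tensor_kernel_add:
  "\<lbrakk>c \<in> tensor_kernel R L M; d \<in> tensor_kernel R L M\<rbrakk> \<Longrightarrow> c + d \<in> tensor_kernel R L M"
  using subgroup.m_closed[OF subgroup_tensor_kernel, of c d] by simp

lemma tensor_kernel_uminus: "c \<in> tensor_kernel R L M \<Longrightarrow> - c \<in> tensor_kernel R L M"
  using subgroup.m_inv_closed[OF subgroup_tensor_kernel, of c]
  by (simp add: keys_tensor_kernel)

lemma tensor_kernel_diff:
  "\<lbrakk>c \<in> tensor_kernel R L M; d \<in> tensor_kernel R L M\<rbrakk> \<Longrightarrow> c - d \<in> tensor_kernel R L M"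
  using tensor_kernel_add[OF _ tensor_kernel_uminus, of c d] by simp

lemma tensor_kernel_sum:
  "(\<And>i. i \<in> S \<Longrightarrow> c i \<in> tensor_kernel R L M) \<Longrightarrow> (\<Sum>i\<in>S. c i) \<in> tensor_kernel R L M"
  by (induction S rule: infinite_finite_induct) (auto simp: tensor_kernel_zero tensor_kernel_add)

lemma tensor_kernel_relations: "tensor_relations R L M \<subseteq> tensor_kernel R L M"
  unfolding tensor_kernel_def by (auto intro: generate.incl)

lemma tensor_kernel_add_left:
  assumes "x \<in> carrier L" "y \<in> carrier L" "m \<in> carrier M"
  shows "frag_of (x \<oplus>\<^bsub>L\<^esub> y, m) - frag_of (x, m) - frag_of (y, m) \<in> tensor_kernel R L M"
  by (rule subsetD[OF tensor_kernel_relations], unfold tensor_relations_def, rule UnI1, rule UnI1)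
    (rule CollectI, rule exI[of _ x], rule exI[of _ y], rule exI[of _ m], simp add: assms)

lemma tensor_kernel_add_right:
  assumes "x \<in> carrier L" "m \<in> carrier M" "n \<in> carrier M"
  shows "frag_of (x, m \<oplus>\<^bsub>M\<^esub> n) - frag_of (x, m) - frag_of (x, n) \<in> tensor_kernel R L M"
  by (rule subsetD[OF tensor_kernel_relations], unfold tensor_relations_def, rule UnI1, rule UnI2)
    (rule CollectI, rule exI[of _ x], rule exI[of _ m], rule exI[of _ n], simp add: assms)

lemma tensor_kernel_smult:
  assumes "a \<in> carrier R" "x \<in> carrier L" "m \<in> carrier M"
  shows "frag_of (a \<odot>\<^bsub>L\<^esub> x, m) - frag_of (x, a \<odot>\<^bsub>M\<^esub> m) \<in> tensor_kernel R L M"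
  by (rule subsetD[OF tensor_kernel_relations], unfold tensor_relations_def, rule UnI2)
    (rule CollectI, rule exI[of _ a], rule exI[of _ x], rule exI[of _ m], simp add: assms)

lemma tensor_kernel_zero_right:
  assumes "x \<in> carrier L"
  shows "frag_of (x, \<zero>\<^bsub>M\<^esub>) \<in> tensor_kernel R L M"
  \<comment> \<open>With both summands zero, the additivity relation is the negative of the
    generator in question.\<close>
  using tensor_kernel_uminus[OF tensor_kernel_add_right[OF assms M.zero_closed M.zero_closed]]
  by simp

lemma tensor_kernel_zero_left:
  assumes "m \<in> carrier M"
  shows "frag_of (\<zero>\<^bsub>L\<^esub>, m) \<in> tensor_kernel R L M"
  using tensor_kernel_uminus[OF tensor_kernel_add_left[OF L.zero_closed L.zero_closed assms]]
  by simp

lemma tensor_kernel_diff_right: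
  assumes "x \<in> carrier L" "m \<in> carrier M" "n \<in> carrier M"
  shows "frag_of (x, m) - frag_of (x, n) - frag_of (x, m \<ominus>\<^bsub>M\<^esub> n) \<in> tensor_kernel R L M"
proof -
  have "(m \<ominus>\<^bsub>M\<^esub> n) \<oplus>\<^bsub>M\<^esub> n = m"
    using assms by (simp add: M.minus_eq M.a_assoc M.l_neg)
  then show ?thesis
    using tensor_kernel_add_right[of x "m \<ominus>\<^bsub>M\<^esub> n" n] assms by (simp add: algebra_simps)
qed

lemma tensor_kernel_finsum_left:
  assumes "finite S" "g \<in> S \<rightarrow> carrier L" "m \<in> carrier M"
  shows "frag_of (finsum L g S, m) - (\<Sum>i\<in>S. frag_of (g i, m)) \<in> tensor_kernel R L M"
  using assms
proof (induction S)
  case empty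
  then show ?case by (simp add: tensor_kernel_zero_left)
next
  case (insert i S)
  have *: "g i \<in> carrier L" "finsum L g S \<in> carrier L"
    using insert.prems by (auto intro: L.finsum_closed)
  have "(frag_of (g i \<oplus>\<^bsub>L\<^esub> finsum L g S, m) - frag_of (g i, m) - frag_of (finsum L g S, m))
      + (frag_of (finsum L g S, m) - (\<Sum>i\<in>S. frag_of (g i, m))) \<in> tensor_kernel R L M"
    using insert by (intro tensor_kernel_add tensor_kernel_add_left *) auto
  then show ?case
    using insert * by (simp add: algebra_simps L.finsum_insert)
qed

end

section \<open>Functoriality of the tensor product in the left module\<close>

lemma frag_extend_tensor_kernel:
  assumes "tensor_factors R L M" "tensor_factors R L N" "f \<in> left_module_hom R M N"
    and "c \<in> tensor_kernel R L M"
  shows "frag_extend (\<lambda>(x, m). frag_of (x, f m)) c \<in> tensor_kernel R L N"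
proof -
  interpret M: tensor_factors R L M by fact
  interpret N: tensor_factors R L N by fact
  have f: "\<And>m. m \<in> carrier M \<Longrightarrow> f m \<in> carrier N"
    "\<And>m m'. \<lbrakk>m \<in> carrier M; m' \<in> carrier M\<rbrakk> \<Longrightarrow> f (m \<oplus>\<^bsub>M\<^esub> m') = f m \<oplus>\<^bsub>N\<^esub> f m'"
    "\<And>a m. \<lbrakk>a \<in> carrier R; m \<in> carrier M\<rbrakk> \<Longrightarrow> f (a \<odot>\<^bsub>M\<^esub> m) = a \<odot>\<^bsub>N\<^esub> f m"
    using assms(3) unfolding left_module_hom_def by (auto simp: hom_def)
  \<comment> \<open>Each of the three kinds of relation is carried to one of the same kind, since
    \<open>f\<close> preserves sums and scalars; additivity of \<open>frag_extend\<close> then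
    covers the generated subgroup.\<close>
  have rel: "frag_extend (\<lambda>(x, m). frag_of (x, f m)) d \<in> tensor_kernel R L N"
    if "d \<in> tensor_relations R L M" for d
    using that unfolding tensor_relations_def
    by (elim UnE CollectE exE conjE; hypsubst)
      (simp_all add: frag_extend_diff f N.tensor_kernel_add_left N.tensor_kernel_add_right
        N.tensor_kernel_smult)
  show ?thesis
    using assms(4) unfolding tensor_kernel_def[of R L M]
  proof induction
    case (inv d)
    then show ?case
      using subsetD[OF M.tensor_relations_subset, of d]
      by (simp add: frag_extend_minus rel N.tensor_kernel_uminus)
  qed (auto simp: N.tensor_kernel_zero rel frag_extend_add N.tensor_kernel_add)
qed

text \<open>Two representatives of a coset differ by an element of the tensor kernel, whose image
  lies in the tensor kernel of \<open>N\<close>. All images thus give one coset, and the set under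
  \<open>the_elem\<close> is a singleton.\<close>

lemma tensor_map_coset:
  fixes L :: "('r, 'l, 'b) module_scheme" and M :: "('r, 'm, 'c) module_scheme"
  assumes "tensor_factors R L M" "tensor_factors R L N" "f \<in> left_module_hom R M N"
    and c: "Poly_Mapping.keys c \<subseteq> carrier L \<times> carrier M"
  shows "tensor_map R L N f (tensor_kernel R L M #>\<^bsub>free_Abelian_group (carrier L \<times> carrier M)\<^esub> c)
    = tensor_kernel R L N #>\<^bsub>free_Abelian_group (carrier L \<times> carrier N)\<^esub>
        frag_extend (\<lambda>(x, m). frag_of (x, f m)) c"
proof -
  interpret M: tensor_factors R L M by fact
  interpret N: tensor_factors R L N by fact
  let ?A = "free_Abelian_group (carrier L \<times> carrier M)"
  let ?B = "free_Abelian_group (carrier L \<times> carrier N)"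
  let ?F = "frag_extend (\<lambda>(x, m). frag_of (x, f m)) :: ('l \<times> 'm \<Rightarrow>\<^sub>0 int) \<Rightarrow> _"
  have fc: "f m \<in> carrier N" if "m \<in> carrier M" for m
    using assms(3) that unfolding left_module_hom_def by (auto simp: hom_def)
  have keysF: "?F d \<in> carrier ?B" if "Poly_Mapping.keys d \<subseteq> carrier L \<times> carrier M" for d
    unfolding carrier_free_Abelian_group_iff
    by (rule subset_trans[OF keys_frag_extend]) (use that fc in auto)
  have const: "tensor_kernel R L N #>\<^bsub>?B\<^esub> ?F d = tensor_kernel R L N #>\<^bsub>?B\<^esub> ?F c"
    if "d \<in> tensor_kernel R L M #>\<^bsub>?A\<^esub> c" for d
  proof -
    from that obtain k where k: "k \<in> tensor_kernel R L M" "d = k + c"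
      by (auto simp: r_coset_def)
    have "?F d \<in> tensor_kernel R L N #>\<^bsub>?B\<^esub> ?F c"
      unfolding r_coset_def k(2) frag_extend_add
      by (rule UN_I[OF frag_extend_tensor_kernel[OF assms(1-3) k(1)]]) simp
    from group.repr_independence[OF group_free_Abelian_group this keysF[OF c] N.subgroup_tensor_kernel]
    show ?thesis ..
  qed
  have self: "c \<in> tensor_kernel R L M #>\<^bsub>?A\<^esub> c"
    using c by (intro group.rcos_self[OF group_free_Abelian_group _ M.subgroup_tensor_kernel]) simp
  have "(\<lambda>d. tensor_kernel R L N #>\<^bsub>?B\<^esub> ?F d) ` (tensor_kernel R L M #>\<^bsub>?A\<^esub> c)
      = (\<lambda>d. tensor_kernel R L N #>\<^bsub>?B\<^esub> ?F c) ` (tensor_kernel R L M #>\<^bsub>?A\<^esub> c)"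
    by (rule image_cong[OF refl const])
  also have "\<dots> = {tensor_kernel R L N #>\<^bsub>?B\<^esub> ?F c}"
    by (rule image_constant[OF self])
  finally show ?thesis
    unfolding tensor_map_def by simp
qed

text \<open>Two cosets with equal image have representatives whose difference is mapped into
  \<open>tensor_kernel R L N\<close>; injectivity becomes the statement \<open>ker\<close> about
  formal sums, without cosets.\<close>

lemma inj_on_tensor_map:
  fixes L :: "('r, 'l, 'b) module_scheme" and M :: "('r, 'm, 'c) module_scheme"
  assumes "tensor_factors R L M" "tensor_factors R L N" "f \<in> left_module_hom R M N"
    and ker: "\<And>c. \<lbrakk>Poly_Mapping.keys c \<subseteq> carrier L \<times> carrier M;
        frag_extend (\<lambda>(x, m). frag_of (x, f m)) c \<in> tensor_kernel R L N\<rbrakk>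
      \<Longrightarrow> c \<in> tensor_kernel R L M"
  shows "inj_on (tensor_map R L N f) (carrier (tensor_product R L M))"
proof (rule inj_onI)
  interpret M: tensor_factors R L M by fact
  interpret N: tensor_factors R L N by fact
  let ?A = "free_Abelian_group (carrier L \<times> carrier M)"
  let ?B = "free_Abelian_group (carrier L \<times> carrier N)"
  let ?F = "frag_extend (\<lambda>(x, m). frag_of (x, f m)) :: ('l \<times> 'm \<Rightarrow>\<^sub>0 int) \<Rightarrow> _"
  fix C D
  assume "C \<in> carrier (tensor_product R L M)" "D \<in> carrier (tensor_product R L M)"
    and eq: "tensor_map R L N f C = tensor_map R L N f D"
  then obtain c d where c: "Poly_Mapping.keys c \<subseteq> carrier L \<times> carrier M" "C = tensor_kernel R L M #>\<^bsub>?A\<^esub> c"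
    and d: "Poly_Mapping.keys d \<subseteq> carrier L \<times> carrier M" "D = tensor_kernel R L M #>\<^bsub>?A\<^esub> d"
    unfolding tensor_product_def by (auto simp: FactGroup_def RCOSETS_def)
  have "?F c \<in> tensor_kernel R L N #>\<^bsub>?B\<^esub> ?F c"
    unfolding r_coset_def by (rule UN_I[OF N.tensor_kernel_zero]) simp
  also have "\<dots> = tensor_kernel R L N #>\<^bsub>?B\<^esub> ?F d"
    using eq c d by (simp add: tensor_map_coset[OF assms(1-3)])
  finally obtain k where "k \<in> tensor_kernel R L N" "?F c = k + ?F d"
    unfolding r_coset_def by auto
  then have "?F (c - d) \<in> tensor_kernel R L N"
    by (simp add: frag_extend_diff)
  then have "c - d \<in> tensor_kernel R L M"
    using c(1) d(1) by (intro ker subset_trans[OF keys_diff]) auto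
  then have "c \<in> tensor_kernel R L M #>\<^bsub>?A\<^esub> d"
    unfolding r_coset_def by (rule UN_I) simp
  from group.repr_independence[OF group_free_Abelian_group this _ M.subgroup_tensor_kernel]
  show "C = D"
    using c d by simp
qed

text \<open>
  The hypotheses say that, along the filter, the \<open>r i\<close> and \<open>q i\<close> behave like a finite dual basis
  of \<open>L\<close>: a directed union of finitely generated projective modules has such data. For a left
  module \<open>M\<close>, the maps \<open>x \<otimes> m \<mapsto> q i x \<cdot> m\<close> then detect whether an element of \<open>L \<otimes> M\<close> vanishes,
  and they commute with homomorphisms \<open>M \<rightarrow> N\<close>.
\<close>

locale eventual_dual_basis = L: right_module R L
  for R :: "('r, 'a) ring_scheme" and L :: "('r, 'l, 'b) module_scheme" +
  fixes F :: "'n filter" and \<Gamma> :: "'n \<Rightarrow> 'i set" and r :: "'i \<Rightarrow> 'l" and q :: "'i \<Rightarrow> 'l \<Rightarrow> 'r"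
  assumes nontrivial: "F \<noteq> bot"
    and finite: "finite (\<Gamma> n)"
    and r_closed: "i \<in> \<Gamma> n \<Longrightarrow> r i \<in> carrier L"
    and q_closed: "\<lbrakk>i \<in> \<Gamma> n; x \<in> carrier L\<rbrakk> \<Longrightarrow> q i x \<in> carrier R"
    and q_add: "\<lbrakk>x \<in> carrier L; y \<in> carrier L\<rbrakk> \<Longrightarrow>
        \<forall>\<^sub>F n in F. \<forall>i\<in>\<Gamma> n. q i (x \<oplus>\<^bsub>L\<^esub> y) = q i x \<oplus>\<^bsub>R\<^esub> q i y"
    and q_smult: "\<lbrakk>a \<in> carrier R; x \<in> carrier L\<rbrakk> \<Longrightarrow>
        \<forall>\<^sub>F n in F. \<forall>i\<in>\<Gamma> n. q i (a \<odot>\<^bsub>L\<^esub> x) = q i x \<otimes>\<^bsub>R\<^esub> a"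
    and expansion: "x \<in> carrier L \<Longrightarrow> \<forall>\<^sub>F n in F. x = (\<Oplus>\<^bsub>L\<^esub>i\<in>\<Gamma> n. q i x \<odot>\<^bsub>L\<^esub> r i)"
begin

text \<open>The map lives on formal sums and not on the tensor product: a single \<open>q i\<close>
  need not be additive or linear, so it has no reason to vanish on the tensor kernel. Existence
  comes from the universal property of the free abelian group.\<close>

definition coord :: "('r, 'm, 'c) module_scheme \<Rightarrow> 'i \<Rightarrow> ('l \<times> 'm \<Rightarrow>\<^sub>0 int) \<Rightarrow> 'm" where
  "coord M i = (SOME h. h \<in> hom (free_Abelian_group (carrier L \<times> carrier M)) (add_monoid M) \<and>
     (\<forall>x\<in>carrier L. \<forall>m\<in>carrier M. h (frag_of (x, m)) = q i x \<odot>\<^bsub>M\<^esub> m))"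

context
  fixes M :: "('r, 'm, 'c) module_scheme"
  assumes M: "left_module R M"
begin

interpretation M: left_module R M by (rule M)
interpretation tensor_factors R L M by unfold_locales

lemma coord:
  assumes "i \<in> \<Gamma> n"
  shows "coord M i \<in> hom (free_Abelian_group (carrier L \<times> carrier M)) (add_monoid M)"
    and "\<lbrakk>x \<in> carrier L; m \<in> carrier M\<rbrakk> \<Longrightarrow> coord M i (frag_of (x, m)) = q i x \<odot>\<^bsub>M\<^esub> m"
proof -
  have "(\<lambda>(x, m). q i x \<odot>\<^bsub>M\<^esub> m) ` (carrier L \<times> carrier M) \<subseteq> carrier (add_monoid M)"
    using q_closed[OF assms] by (auto intro!: M.smult_closed)
  from comm_group.free_Abelian_group_universal[OF M.a_comm_group this]
  obtain h where "h \<in> hom (free_Abelian_group (carrier L \<times> carrier M)) (add_monoid M)"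
    and "\<And>z. z \<in> carrier L \<times> carrier M \<Longrightarrow> h (frag_of z) = (\<lambda>(x, m). q i x \<odot>\<^bsub>M\<^esub> m) z"
    by blast
  then have "\<exists>h. h \<in> hom (free_Abelian_group (carrier L \<times> carrier M)) (add_monoid M) \<and>
     (\<forall>x\<in>carrier L. \<forall>m\<in>carrier M. h (frag_of (x, m)) = q i x \<odot>\<^bsub>M\<^esub> m)"
    by (intro exI[of _ h]) simp
  note * = someI_ex[OF this, folded coord_def]
  show "coord M i \<in> hom (free_Abelian_group (carrier L \<times> carrier M)) (add_monoid M)"
    using * by (rule conjunct1)
  show "coord M i (frag_of (x, m)) = q i x \<odot>\<^bsub>M\<^esub> m" if "x \<in> carrier L" "m \<in> carrier M"
    using * that by blast
qed

lemma coord_closed: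
  "\<lbrakk>i \<in> \<Gamma> n; Poly_Mapping.keys c \<subseteq> carrier L \<times> carrier M\<rbrakk> \<Longrightarrow> coord M i c \<in> carrier M"
  using hom_in_carrier[OF coord(1), of i n c] by simp

lemma coord_add:
  "\<lbrakk>i \<in> \<Gamma> n; Poly_Mapping.keys c \<subseteq> carrier L \<times> carrier M; Poly_Mapping.keys d \<subseteq> carrier L \<times> carrier M\<rbrakk>
    \<Longrightarrow> coord M i (c + d) = coord M i c \<oplus>\<^bsub>M\<^esub> coord M i d"
  using hom_mult[OF coord(1), of i n c d] by simp

lemma coord_zero: "i \<in> \<Gamma> n \<Longrightarrow> coord M i 0 = \<zero>\<^bsub>M\<^esub>"
  using hom_one[OF coord(1) group_free_Abelian_group M.a_group, of i n] by simp

lemma coord_diff: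
  assumes "i \<in> \<Gamma> n" "Poly_Mapping.keys c \<subseteq> carrier L \<times> carrier M"
    "Poly_Mapping.keys d \<subseteq> carrier L \<times> carrier M"
  shows "coord M i (c - d) = coord M i c \<ominus>\<^bsub>M\<^esub> coord M i d"
proof -
  have cd: "Poly_Mapping.keys (c - d) \<subseteq> carrier L \<times> carrier M"
    by (rule subset_trans[OF keys_diff]) (use assms in auto)
  have "coord M i c = coord M i (c - d) \<oplus>\<^bsub>M\<^esub> coord M i d"
    using coord_add[OF assms(1) cd assms(3)] by simp
  then show ?thesis
    using coord_closed[OF assms(1) cd] coord_closed[OF assms(1,3)]
    by (simp add: M.minus_eq M.a_assoc M.r_neg)
qed

lemma coord_frag_of_diff:
  assumes "i \<in> \<Gamma> n" "z \<in> carrier L \<times> carrier M" "z' \<in> carrier L \<times> carrier M" "z'' \<in> carrier L \<times> carrier M"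
  shows "coord M i (frag_of z - frag_of z' - frag_of z'')
    = coord M i (frag_of z) \<ominus>\<^bsub>M\<^esub> coord M i (frag_of z') \<ominus>\<^bsub>M\<^esub> coord M i (frag_of z'')"
proof -
  have "Poly_Mapping.keys (frag_of z - frag_of z') \<subseteq> carrier L \<times> carrier M"
    by (rule subset_trans[OF keys_diff]) (use assms in auto)
  then show ?thesis
    using assms by (simp only: coord_diff[OF assms(1)] keys_frag_of empty_subsetI insert_subset)
qed

text \<open>The index from which the coordinates vanish depends on the relation: additivity in
  \<open>L\<close> calls for \<open>q_add\<close> at its two elements, balancing for
  \<open>q_smult\<close> at its scalar.\<close>

lemma eventually_coord_tensor_relations:
  assumes "c \<in> tensor_relations R L M"
  shows "\<forall>\<^sub>F n in F. \<forall>i\<in>\<Gamma> n. coord M i c = \<zero>\<^bsub>M\<^esub>"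
proof -
  have left: "\<forall>\<^sub>F n in F. \<forall>i\<in>\<Gamma> n. coord M i c = \<zero>\<^bsub>M\<^esub>"
    if left: "x \<in> carrier L" "y \<in> carrier L" "m \<in> carrier M"
      "c = frag_of (x \<oplus>\<^bsub>L\<^esub> y, m) - frag_of (x, m) - frag_of (y, m)" for x y m
  proof -
    from q_add[OF left(1,2)] show ?thesis
    proof eventually_elim
      case (elim n)
      show ?case
      proof
        fix i assume i: "i \<in> \<Gamma> n"
        have "coord M i c = coord M i (frag_of (x \<oplus>\<^bsub>L\<^esub> y, m)) \<ominus>\<^bsub>M\<^esub> coord M i (frag_of (x, m))
            \<ominus>\<^bsub>M\<^esub> coord M i (frag_of (y, m))"
          unfolding left(4) using left(1-3) by (intro coord_frag_of_diff[OF i]) auto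
        also have "\<dots> = q i (x \<oplus>\<^bsub>L\<^esub> y) \<odot>\<^bsub>M\<^esub> m \<ominus>\<^bsub>M\<^esub> q i x \<odot>\<^bsub>M\<^esub> m \<ominus>\<^bsub>M\<^esub> q i y \<odot>\<^bsub>M\<^esub> m"
          using left(1-3) by (simp only: coord(2)[OF i] L.a_closed)
        also have "q i (x \<oplus>\<^bsub>L\<^esub> y) \<odot>\<^bsub>M\<^esub> m = q i x \<odot>\<^bsub>M\<^esub> m \<oplus>\<^bsub>M\<^esub> q i y \<odot>\<^bsub>M\<^esub> m"
          using left(1-3) elim i by (simp only: M.smult_l_distr q_closed[OF i])
        also have "q i x \<odot>\<^bsub>M\<^esub> m \<oplus>\<^bsub>M\<^esub> q i y \<odot>\<^bsub>M\<^esub> m \<ominus>\<^bsub>M\<^esub> q i x \<odot>\<^bsub>M\<^esub> m \<ominus>\<^bsub>M\<^esub> q i y \<odot>\<^bsub>M\<^esub> m = \<zero>\<^bsub>M\<^esub>"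
          using left(1-3) by (intro M.add_minus_minus M.smult_closed q_closed[OF i])
        finally show "coord M i c = \<zero>\<^bsub>M\<^esub>" .
      qed
    qed
  qed
  have right: "\<forall>\<^sub>F n in F. \<forall>i\<in>\<Gamma> n. coord M i c = \<zero>\<^bsub>M\<^esub>"
    if right: "x \<in> carrier L" "m \<in> carrier M" "n \<in> carrier M"
      "c = frag_of (x, m \<oplus>\<^bsub>M\<^esub> n) - frag_of (x, m) - frag_of (x, n)" for x m n
  proof -
    show ?thesis
    \<comment> \<open>Here \<open>q i\<close> is applied to the one element \<open>x\<close> only,
      so the identity holds at every index.\<close>
    proof (intro always_eventually allI ballI)
      fix n' i assume i: "i \<in> \<Gamma> n'"
      have "coord M i c = coord M i (frag_of (x, m \<oplus>\<^bsub>M\<^esub> n)) \<ominus>\<^bsub>M\<^esub> coord M i (frag_of (x, m))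
          \<ominus>\<^bsub>M\<^esub> coord M i (frag_of (x, n))"
        unfolding right(4) using right(1-3) by (intro coord_frag_of_diff[OF i]) auto
      also have "\<dots> = q i x \<odot>\<^bsub>M\<^esub> (m \<oplus>\<^bsub>M\<^esub> n) \<ominus>\<^bsub>M\<^esub> q i x \<odot>\<^bsub>M\<^esub> m \<ominus>\<^bsub>M\<^esub> q i x \<odot>\<^bsub>M\<^esub> n"
        using right(1-3) by (simp only: coord(2)[OF i] M.a_closed)
      also have "q i x \<odot>\<^bsub>M\<^esub> (m \<oplus>\<^bsub>M\<^esub> n) = q i x \<odot>\<^bsub>M\<^esub> m \<oplus>\<^bsub>M\<^esub> q i x \<odot>\<^bsub>M\<^esub> n"
        using right(1-3) by (intro M.smult_r_distr q_closed[OF i])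
      also have "q i x \<odot>\<^bsub>M\<^esub> m \<oplus>\<^bsub>M\<^esub> q i x \<odot>\<^bsub>M\<^esub> n \<ominus>\<^bsub>M\<^esub> q i x \<odot>\<^bsub>M\<^esub> m \<ominus>\<^bsub>M\<^esub> q i x \<odot>\<^bsub>M\<^esub> n = \<zero>\<^bsub>M\<^esub>"
        using right(1-3) by (intro M.add_minus_minus M.smult_closed q_closed[OF i])
      finally show "coord M i c = \<zero>\<^bsub>M\<^esub>" .
    qed
  qed
  have smult: "\<forall>\<^sub>F n in F. \<forall>i\<in>\<Gamma> n. coord M i c = \<zero>\<^bsub>M\<^esub>"
    if smult: "a \<in> carrier R" "x \<in> carrier L" "m \<in> carrier M"
      "c = frag_of (a \<odot>\<^bsub>L\<^esub> x, m) - frag_of (x, a \<odot>\<^bsub>M\<^esub> m)" for a x m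
  proof -
    from q_smult[OF smult(1,2)] show ?thesis
    proof eventually_elim
      case (elim n)
      show ?case
      proof
        fix i assume i: "i \<in> \<Gamma> n"
        have "coord M i c = coord M i (frag_of (a \<odot>\<^bsub>L\<^esub> x, m)) \<ominus>\<^bsub>M\<^esub> coord M i (frag_of (x, a \<odot>\<^bsub>M\<^esub> m))"
          unfolding smult(4) using smult(1-3)
          by (intro coord_diff[OF i]) (auto simp: keys_frag_of L.smult_closed M.smult_closed)
        also have "\<dots> = q i (a \<odot>\<^bsub>L\<^esub> x) \<odot>\<^bsub>M\<^esub> m \<ominus>\<^bsub>M\<^esub> q i x \<odot>\<^bsub>M\<^esub> (a \<odot>\<^bsub>M\<^esub> m)"
          using smult(1-3) by (simp only: coord(2)[OF i] L.smult_closed M.smult_closed)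
        also have "q i (a \<odot>\<^bsub>L\<^esub> x) \<odot>\<^bsub>M\<^esub> m = q i x \<odot>\<^bsub>M\<^esub> (a \<odot>\<^bsub>M\<^esub> m)"
          using smult(1-3) elim i by (simp only: M.smult_assoc q_closed[OF i])
        also have "q i x \<odot>\<^bsub>M\<^esub> (a \<odot>\<^bsub>M\<^esub> m) \<ominus>\<^bsub>M\<^esub> q i x \<odot>\<^bsub>M\<^esub> (a \<odot>\<^bsub>M\<^esub> m) = \<zero>\<^bsub>M\<^esub>"
          using smult(1-3) unfolding M.minus_eq by (intro M.r_neg M.smult_closed q_closed[OF i])
        finally show "coord M i c = \<zero>\<^bsub>M\<^esub>" .
      qed
    qed
  qed
  from assms show ?thesis
    unfolding tensor_relations_def
    by (elim UnE CollectE exE conjE) (rule left right smult, assumption, assumption, assumption, assumption)+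
qed

text \<open>An element of the kernel is a finite combination of relations, and finitely many
  eventual statements hold jointly along a filter.\<close>

lemma eventually_coord_tensor_kernel:
  assumes "c \<in> tensor_kernel R L M"
  shows "\<forall>\<^sub>F n in F. \<forall>i\<in>\<Gamma> n. coord M i c = \<zero>\<^bsub>M\<^esub>"
proof -
  have sub: "Poly_Mapping.keys c \<subseteq> carrier L \<times> carrier M" if "c \<in> tensor_kernel R L M" for c
    using keys_tensor_kernel[OF that] .
  show ?thesis
    using assms unfolding tensor_kernel_def
  proof induction
    case one
    then show ?case by (auto simp: coord_zero)
  next
    case (incl c)
    then show ?case by (rule eventually_coord_tensor_relations)
  next
    case (inv c)
    then have c: "Poly_Mapping.keys c \<subseteq> carrier L \<times> carrier M"
      using subsetD[OF tensor_relations_subset, of c] by (simp only: carrier_free_Abelian_group_iff)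
    from eventually_coord_tensor_relations[OF inv] show ?case
    proof eventually_elim
      case (elim n)
      show ?case
      proof
        fix i assume i: "i \<in> \<Gamma> n"
        show "coord M i (inv\<^bsub>free_Abelian_group (carrier L \<times> carrier M)\<^esub> c) = \<zero>\<^bsub>M\<^esub>"
          using coord_diff[OF i, of 0 c] elim i c by (simp add: coord_zero[OF i] M.minus_eq)
      qed
    qed
  next
    case (eng c d)
    then have *: "Poly_Mapping.keys c \<subseteq> carrier L \<times> carrier M" "Poly_Mapping.keys d \<subseteq> carrier L \<times> carrier M"
      using sub unfolding tensor_kernel_def by auto
    from eng.IH show ?case
      by eventually_elim (auto simp: coord_add[OF _ *])
  qed
qed

text \<open>The dual basis identity for tensors: on a generator (x, m), expand x, split the sum in
  the left entry, and move each scalar \<open>q i x\<close> over to m.\<close>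

lemma eventually_coord_expansion:
  assumes "Poly_Mapping.keys c \<subseteq> carrier L \<times> carrier M"
  shows "\<forall>\<^sub>F n in F. c - (\<Sum>i\<in>\<Gamma> n. frag_of (r i, coord M i c)) \<in> tensor_kernel R L M"
  using assms
proof (induction c rule: free_Abelian_group_induct[consumes 1, case_names zero diff single])
  case zero
  then show ?case
    by (auto simp: coord_zero r_closed intro!: always_eventually tensor_kernel_diff
        tensor_kernel_zero tensor_kernel_sum tensor_kernel_zero_right simp del: diff_0)
next
  case (diff c d)
  from diff(3,4) show ?case
  proof eventually_elim
    case (elim n)
    \<comment> \<open>The coordinates of \<open>c - d\<close> are differences; the last sum collects
      the relations that split these differences in the right entry.\<close>
    have "c - (\<Sum>i\<in>\<Gamma> n. frag_of (r i, coord M i c)) - (d - (\<Sum>i\<in>\<Gamma> n. frag_of (r i, coord M i d)))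
        + (\<Sum>i\<in>\<Gamma> n. frag_of (r i, coord M i c) - frag_of (r i, coord M i d)
             - frag_of (r i, coord M i c \<ominus>\<^bsub>M\<^esub> coord M i d)) \<in> tensor_kernel R L M"
      using elim diff(1,2)
      by (intro tensor_kernel_add tensor_kernel_diff[of "c - _"] tensor_kernel_sum tensor_kernel_diff_right)
        (auto intro: r_closed coord_closed)
    moreover have "(\<Sum>i\<in>\<Gamma> n. frag_of (r i, coord M i (c - d)))
        = (\<Sum>i\<in>\<Gamma> n. frag_of (r i, coord M i c \<ominus>\<^bsub>M\<^esub> coord M i d))"
      using coord_diff[OF _ diff(1,2)] by (intro sum.cong) auto
    ultimately show ?case
      by (simp add: sum_subtractf sum.distrib algebra_simps)
  qed
next
  case (single z)
  then obtain x m where z: "z = (x, m)" and x: "x \<in> carrier L" and m: "m \<in> carrier M"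
    by auto
  from expansion[OF x] show ?case
  proof eventually_elim
    case (elim n)
    let ?g = "\<lambda>i. q i x \<odot>\<^bsub>L\<^esub> r i"
    have g: "?g \<in> \<Gamma> n \<rightarrow> carrier L"
      using x by (auto intro!: L.smult_closed q_closed r_closed)
    have "frag_of (finsum L ?g (\<Gamma> n), m) - (\<Sum>i\<in>\<Gamma> n. frag_of (?g i, m))
        + (\<Sum>i\<in>\<Gamma> n. frag_of (?g i, m) - frag_of (r i, q i x \<odot>\<^bsub>M\<^esub> m)) \<in> tensor_kernel R L M"
      using x m
      by (intro tensor_kernel_add tensor_kernel_sum tensor_kernel_smult tensor_kernel_finsum_left finite g)
        (auto intro: r_closed q_closed)
    moreover have "(\<Sum>i\<in>\<Gamma> n. frag_of (r i, coord M i (frag_of z)))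
        = (\<Sum>i\<in>\<Gamma> n. frag_of (r i, q i x \<odot>\<^bsub>M\<^esub> m))"
      using x m by (intro sum.cong) (auto simp: z coord(2))
    ultimately show ?case
      using elim by (simp add: z sum_subtractf)
  qed
qed

text \<open>Once all coordinates are zero, the expansion of \<open>c\<close> consists of terms with
  right entry zero. Together with the vanishing on the kernel this makes the coordinates a complete
  test.\<close>

lemma tensor_kernelI:
  assumes "Poly_Mapping.keys c \<subseteq> carrier L \<times> carrier M"
    and "\<forall>\<^sub>F n in F. \<forall>i\<in>\<Gamma> n. coord M i c = \<zero>\<^bsub>M\<^esub>"
  shows "c \<in> tensor_kernel R L M"
proof -
  have "\<forall>\<^sub>F n in F. c \<in> tensor_kernel R L M"
    using eventually_coord_expansion[OF assms(1)] assms(2)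
  proof eventually_elim
    case (elim n)
    have "(\<Sum>i\<in>\<Gamma> n. frag_of (r i, coord M i c)) \<in> tensor_kernel R L M"
      using elim(2) by (auto intro!: tensor_kernel_sum tensor_kernel_zero_right r_closed)
    from tensor_kernel_add[OF elim(1) this] show ?case
      by simp
  qed
  \<comment> \<open>The membership does not mention \<open>n\<close>, so along a nontrivial filter
    it holds outright.\<close>
  then show ?thesis
    using nontrivial by (simp add: eventually_const)
qed

end

text \<open>A coordinate multiplies the right entry by a scalar that depends on the left entry
  alone, and \<open>f\<close> commutes with scalars. Hence this holds at every index, not just
  eventually.\<close>

lemma coord_natural:
  fixes M :: "('r, 'm, 'c) module_scheme"
  assumes M: "left_module R M" and N: "left_module R N" and f: "f \<in> left_module_hom R M N"
    and i: "i \<in> \<Gamma> n" and c: "Poly_Mapping.keys c \<subseteq> carrier L \<times> carrier M"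
  shows "coord N i (frag_extend (\<lambda>(x, m). frag_of (x, f m)) c) = f (coord M i c)"
proof -
  interpret M: left_module R M by fact
  interpret N: left_module R N by fact
  let ?F = "frag_extend (\<lambda>(x, m). frag_of (x, f m)) :: ('l \<times> 'm \<Rightarrow>\<^sub>0 int) \<Rightarrow> _"
  have fm: "f \<in> hom (add_monoid M) (add_monoid N)"
    and fa: "\<And>a m. \<lbrakk>a \<in> carrier R; m \<in> carrier M\<rbrakk> \<Longrightarrow> f (a \<odot>\<^bsub>M\<^esub> m) = a \<odot>\<^bsub>N\<^esub> f m"
    using f by (auto simp: left_module_hom_def)
  interpret f: abelian_group_hom M N f
    using fm by unfold_locales (auto simp: hom_def)
  have keysF: "Poly_Mapping.keys (?F d) \<subseteq> carrier L \<times> carrier N"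
    if "Poly_Mapping.keys d \<subseteq> carrier L \<times> carrier M" for d
    by (rule subset_trans[OF keys_frag_extend]) (use that in auto)
  show ?thesis
    using c
  proof (induction c rule: free_Abelian_group_induct[consumes 1, case_names zero diff single])
    case zero
    then show ?case by (simp add: coord_zero[OF M i] coord_zero[OF N i])
  next
    case (diff c d)
    then show ?case
      using coord_closed[OF M i] 
      by (simp add: frag_extend_diff coord_diff[OF M i] coord_diff[OF N i] keysF M.minus_eq N.minus_eq)
  next
    case (single z)
    then show ?case
      by (auto simp: coord(2)[OF M i] coord(2)[OF N i] fa q_closed[OF i])
  qed
qed

text \<open>If the image of \<open>c\<close> represents zero, the elements
  \<open>f (coord M i c)\<close> vanish eventually; injectivity of \<open>f\<close> brings this back
  to \<open>M\<close>, where vanishing coordinates put \<open>c\<close> into the kernel.\<close>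

lemma flat: "flat_right_module TYPE('m) TYPE('p) R L"
  unfolding flat_right_module_def
proof (intro conjI allI impI)
  show "right_module R L"
    by (rule L.right_module_axioms)
next
  fix M :: "('r, 'm) module" and N :: "('r, 'p) module" and f
  assume M: "left_module R M" and N: "left_module R N" and f: "f \<in> left_module_hom R M N"
    and inj: "inj_on f (carrier M)"
  interpret M: left_module R M by fact
  interpret N: left_module R N by fact
  have tf: "tensor_factors R L M" "tensor_factors R L N"
    by unfold_locales
  have f0: "f \<zero>\<^bsub>M\<^esub> = \<zero>\<^bsub>N\<^esub>"
    using f hom_one[of f "add_monoid M" "add_monoid N"] M.a_group N.a_group
    unfolding left_module_hom_def by simp
  show "inj_on (tensor_map R L N f) (carrier (tensor_product R L M))"
  proof (rule inj_on_tensor_map[OF tf f])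
    fix c :: "'l \<times> 'm \<Rightarrow>\<^sub>0 int"
    assume c: "Poly_Mapping.keys c \<subseteq> carrier L \<times> carrier M"
      and "frag_extend (\<lambda>(x, m). frag_of (x, f m)) c \<in> tensor_kernel R L N"
    from eventually_coord_tensor_kernel[OF N this(2)]
    have "\<forall>\<^sub>F n in F. \<forall>i\<in>\<Gamma> n. coord M i c = \<zero>\<^bsub>M\<^esub>"
    proof eventually_elim
      case (elim n)
      show ?case
      proof
        fix i assume i: "i \<in> \<Gamma> n"
        have "f (coord M i c) = f \<zero>\<^bsub>M\<^esub>"
          using elim i coord_natural[OF M N f i c] f0 by simp
        then show "coord M i c = \<zero>\<^bsub>M\<^esub>"
          using inj coord_closed[OF M i c] by (auto dest: inj_onD)
      qed
    qed
    then show "c \<in> tensor_kernel R L M"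
      by (rule tensor_kernelI[OF M c])
  qed
qed

end

section \<open>Algebras with a basis\<close>

definition pm_scale :: "'k::field \<Rightarrow> ('a \<Rightarrow>\<^sub>0 'k) \<Rightarrow> ('a \<Rightarrow>\<^sub>0 'k)"
  where "pm_scale c f = Poly_Mapping.map ((*) c) f"

lemma lookup_pm_scale [simp]: "Poly_Mapping.lookup (pm_scale c f) x = c * Poly_Mapping.lookup f x"
  unfolding pm_scale_def by (simp add: Poly_Mapping.map.rep_eq when_def)

interpretation pm: vector_space pm_scale
  by unfold_locales (auto intro!: poly_mapping_eqI simp: lookup_add algebra_simps)

lemma keys_pm_scale: "Poly_Mapping.keys (pm_scale c f) \<subseteq> Poly_Mapping.keys f"
  by (auto simp: in_keys_iff)

lemma pm_scale_single [simp]: "pm_scale c (Poly_Mapping.single x a) = Poly_Mapping.single x (c * a)"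
  by (rule poly_mapping_eqI) (simp add: lookup_single when_def)

text \<open>Products, the action on ghost paths and the ghost embedding all have this shape, which
  reduces their identities to basis elements.\<close>

definition lin :: "('a \<Rightarrow> ('b \<Rightarrow>\<^sub>0 'k)) \<Rightarrow> ('a \<Rightarrow>\<^sub>0 'k::field) \<Rightarrow> ('b \<Rightarrow>\<^sub>0 'k)"
  where "lin T f = (\<Sum>x\<in>Poly_Mapping.keys f. pm_scale (Poly_Mapping.lookup f x) (T x))"

lemma lin_superset:
  assumes "finite S" "Poly_Mapping.keys f \<subseteq> S"
  shows "lin T f = (\<Sum>x\<in>S. pm_scale (Poly_Mapping.lookup f x) (T x))"
  unfolding lin_def using assms
  by (intro sum.mono_neutral_left) (auto simp: in_keys_iff)

lemma lin_single [simp]: "lin T (Poly_Mapping.single x a) = pm_scale a (T x)"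
  by (subst lin_superset[of "{x}"]) auto

lemma lin_add: "lin T (f + g) = lin T f + lin T g"
proof -
  have "Poly_Mapping.keys (f + g) \<subseteq> Poly_Mapping.keys f \<union> Poly_Mapping.keys g"
    by (rule keys_add)
  then show ?thesis
    by (simp add: lin_superset[of "Poly_Mapping.keys f \<union> Poly_Mapping.keys g"] lookup_add
        pm.scale_left_distrib sum.distrib)
qed

lemma lin_scale: "lin T (pm_scale c f) = pm_scale c (lin T f)"
  by (simp add: lin_superset[of "Poly_Mapping.keys f"] keys_pm_scale pm.scale_sum_right)

lemma lin_zero [simp]: "lin T 0 = 0"
  by (simp add: lin_def)

lemma lin_uminus: "lin T (- f) = - lin T f"
  using lin_add[of T f "- f"] by (simp add: add_eq_0_iff)

lemma lin_diff: "lin T (f - g) = lin T f - lin T g"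
  using lin_add[of T f "- g"] by (simp add: lin_uminus)

lemma lin_sum: "lin T (\<Sum>i\<in>S. f i) = (\<Sum>i\<in>S. lin T (f i))"
  by (induction S rule: infinite_finite_induct) (auto simp: lin_add)

lemma lin_cong:
  "(\<And>x. x \<in> Poly_Mapping.keys f \<Longrightarrow> T x = T' x) \<Longrightarrow> lin T f = lin T' f"
  by (simp add: lin_def)

lemma lin_fun_zero [simp]: "lin (\<lambda>x. 0) f = 0"
  by (simp add: lin_def)

lemma lin_fun_add: "lin (\<lambda>x. T x + T' x) f = lin T f + lin T' f"
  by (simp add: lin_def pm.scale_right_distrib sum.distrib)

lemma lin_fun_diff: "lin (\<lambda>x. T x - T' x) f = lin T f - lin T' f"
  by (simp add: lin_def pm.scale_right_diff_distrib sum_subtractf)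

lemma lin_fun_scale: "lin (\<lambda>x. pm_scale c (T x)) f = pm_scale c (lin T f)"
  by (simp add: lin_def pm.scale_sum_right mult.commute)

lemma lin_fun_sum: "lin (\<lambda>x. \<Sum>i\<in>S. T i x) f = (\<Sum>i\<in>S. lin (T i) f)"
  by (induction S rule: infinite_finite_induct) (auto simp: lin_fun_add)

lemma lin_lin: "lin T (lin S f) = lin (\<lambda>x. lin T (S x)) f"
  unfolding lin_def[of S] lin_def[of "\<lambda>x. lin T (S x)"] by (simp add: lin_sum lin_scale)

text \<open>A bilinear extension can be evaluated in either order of its arguments. Associativity
  and the left unit law use the order opposite to the one in \<open>bilin\<close>.\<close>

lemma lin_swap: "lin (\<lambda>x. lin (T x) g) f = lin (\<lambda>y. lin (\<lambda>x. T x y) f) g"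
  unfolding lin_def[of _ g] by (simp add: lin_fun_sum lin_fun_scale)

lemma lin_basis [simp]: "lin (\<lambda>x. Poly_Mapping.single x 1) f = f"
  by (rule poly_mapping_eqI)
    (auto simp: lin_def lookup_sum lookup_single when_def in_keys_iff)

lemma keys_lin: "Poly_Mapping.keys (lin T f) \<subseteq> (\<Union>x\<in>Poly_Mapping.keys f. Poly_Mapping.keys (T x))"
  unfolding lin_def using keys_pm_scale by (fastforce dest: subsetD[OF keys_sum])

lemma lin_in_subspace:
  assumes "pm.subspace U" "\<And>x. x \<in> Poly_Mapping.keys f \<Longrightarrow> T x \<in> U"
  shows "lin T f \<in> U"
  unfolding lin_def using assms by (intro pm.subspace_sum pm.subspace_scale)

definition bilin :: "('a \<Rightarrow> 'a \<Rightarrow> ('a \<Rightarrow>\<^sub>0 'k)) \<Rightarrow> ('a \<Rightarrow>\<^sub>0 'k) \<Rightarrow> ('a \<Rightarrow>\<^sub>0 'k) \<Rightarrow> ('a \<Rightarrow>\<^sub>0 'k::field)"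
  where "bilin T f g = lin (\<lambda>x. lin (T x) g) f"

lemma bilin_assoc:
  assumes "\<And>x y z. \<lbrakk>x \<in> S; y \<in> S; z \<in> S\<rbrakk> \<Longrightarrow> lin (\<lambda>w. T w z) (T x y) = lin (T x) (T y z)"
    and "Poly_Mapping.keys f \<subseteq> S" "Poly_Mapping.keys g \<subseteq> S" "Poly_Mapping.keys h \<subseteq> S"
  shows "bilin T (bilin T f g) h = bilin T f (bilin T g h)"
proof -
  have "lin (\<lambda>w. lin (T w) h) (T x y) = lin (T x) (lin (T y) h)"
    if "x \<in> Poly_Mapping.keys f" "y \<in> Poly_Mapping.keys g" for x y
    unfolding lin_swap[of T] lin_lin using that assms(2-4) by (intro lin_cong assms(1)) auto
  then show ?thesis
    unfolding bilin_def lin_lin by (intro lin_cong) auto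
qed

lemma keys_bilin:
  assumes "\<And>x y. \<lbrakk>x \<in> S; y \<in> S\<rbrakk> \<Longrightarrow> Poly_Mapping.keys (T x y) \<subseteq> S"
    and "Poly_Mapping.keys f \<subseteq> S" "Poly_Mapping.keys g \<subseteq> S"
  shows "Poly_Mapping.keys (bilin T f g) \<subseteq> S"
  unfolding bilin_def using assms by (fastforce dest!: subsetD[OF keys_lin])

text \<open>The laws are confined to \<open>S\<close> because path composition has its unit laws
  only on genuine paths: the unit sums over the vertices of the quiver and annihilates a pair whose
  source is no vertex.\<close>

lemma ring_bilin:
  fixes T :: "'a \<Rightarrow> 'a \<Rightarrow> ('a \<Rightarrow>\<^sub>0 'k::field)"
  assumes closed: "\<And>x y. \<lbrakk>x \<in> S; y \<in> S\<rbrakk> \<Longrightarrow> Poly_Mapping.keys (T x y) \<subseteq> S"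
    and assoc: "\<And>x y z. \<lbrakk>x \<in> S; y \<in> S; z \<in> S\<rbrakk> \<Longrightarrow> lin (\<lambda>w. T w z) (T x y) = lin (T x) (T y z)"
    and one: "Poly_Mapping.keys e \<subseteq> S"
    and l_one: "\<And>x. x \<in> S \<Longrightarrow> lin (\<lambda>w. T w x) e = Poly_Mapping.single x 1"
    and r_one: "\<And>x. x \<in> S \<Longrightarrow> lin (T x) e = Poly_Mapping.single x 1"
  shows "ring \<lparr>carrier = {f. Poly_Mapping.keys f \<subseteq> S}, monoid.mult = bilin T, one = e,
    ring.zero = 0, ring.add = (+)\<rparr>" (is "ring ?R")
proof (rule ringI)
  show "abelian_group ?R"
  proof (rule abelian_groupI)
    fix f assume f: "f \<in> carrier ?R"
    show "\<exists>g\<in>carrier ?R. g \<oplus>\<^bsub>?R\<^esub> f = \<zero>\<^bsub>?R\<^esub>"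
      by (rule bexI[of _ "- f"]) (use f in auto)
  qed (auto simp: algebra_simps dest!: subsetD[OF keys_add])
  show "Group.monoid ?R"
  proof (rule monoidI)
    fix f assume f: "f \<in> carrier ?R"
    have "lin (\<lambda>x. lin (T x) f) e = lin (\<lambda>x. Poly_Mapping.single x 1) f"
      unfolding lin_swap[of T] using l_one f by (intro lin_cong) auto
    then show "\<one>\<^bsub>?R\<^esub> \<otimes>\<^bsub>?R\<^esub> f = f"
      by (simp add: bilin_def)
    have "lin (\<lambda>x. lin (T x) e) f = lin (\<lambda>x. Poly_Mapping.single x 1) f"
      using r_one f by (intro lin_cong) auto
    then show "f \<otimes>\<^bsub>?R\<^esub> \<one>\<^bsub>?R\<^esub> = f"
      by (simp add: bilin_def)
  qed (use one keys_bilin[OF closed] bilin_assoc[OF assoc] in auto)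
qed (auto simp: bilin_def lin_add lin_fun_add)

section \<open>Path algebras and free algebras as rings\<close>

definition path_comp :: "('v, 'e) pre_digraph \<Rightarrow> ('v, 'e) path \<Rightarrow> ('v, 'e) path \<Rightarrow> (('v, 'e) path \<Rightarrow>\<^sub>0 'k::field)"
  where "path_comp G x y =
    (if path_target G x = fst y then Poly_Mapping.single (fst x, snd x @ snd y) 1 else 0)"

lemma path_algebra_eq:
  "path_algebra G = \<lparr>carrier = {f. Poly_Mapping.keys f \<subseteq> paths G}, monoid.mult = bilin (path_comp G),
     one = (\<Sum>v\<in>verts G. Poly_Mapping.single (v, []) 1), ring.zero = 0, ring.add = (+)\<rparr>"
proof -
  have "(\<lambda>f g. \<Sum>x\<in>Poly_Mapping.keys f. \<Sum>y\<in>Poly_Mapping.keys g.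
       (if path_target G x = fst y
        then Poly_Mapping.single (fst x, snd x @ snd y)
               (Poly_Mapping.lookup f x * Poly_Mapping.lookup g y)
        else 0)) = bilin (path_comp G)"
    by (intro ext) (auto simp: bilin_def lin_def path_comp_def pm.scale_sum_right intro!: sum.cong)
  then show ?thesis
    unfolding path_algebra_def by simp
qed

context wf_digraph
begin

lemma awalk_path_target: "x \<in> paths G \<Longrightarrow> awalk (fst x) (snd x) (path_target G x)"
  unfolding paths_def path_target_def by auto

lemma path_target_eqI: "awalk u p v \<Longrightarrow> path_target G (u, p) = v"
  unfolding path_target_def by auto

lemma paths_append_iff:
  "(u, p @ q) \<in> paths G \<longleftrightarrow> (u, p) \<in> paths G \<and> (path_target G (u, p), q) \<in> paths G"
  unfolding paths_def using path_target_eqI by (auto simp: awalk_append_iff) metis+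

lemma path_target_append:
  "\<lbrakk>(u, p) \<in> paths G; (path_target G (u, p), q) \<in> paths G\<rbrakk> \<Longrightarrow>
    path_target G (u, p @ q) = path_target G (path_target G (u, p), q)"
  using awalk_path_target[of "(u, p)"] awalk_path_target[of "(path_target G (u, p), q)"]
  by (intro path_target_eqI) (auto simp: awalk_append_iff)

end

text \<open>For the unit laws, exactly one summand of the unit composes with a path on either side:
  the trivial path at its source, respectively at its target.\<close>

lemma (in fin_digraph) ring_path_algebra:
  "ring (path_algebra G :: (('a, 'b) path \<Rightarrow>\<^sub>0 'k::field) ring)"
  unfolding path_algebra_eq
proof (rule ring_bilin)
  have trivial: "(v, []) \<in> paths G" "path_target G (v, []) = v" if "v \<in> verts G" for v
    using that by (auto simp: paths_def path_target_def awalk_Nil_iff)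
  show "Poly_Mapping.keys (\<Sum>v\<in>verts G. Poly_Mapping.single (v, []) (1::'k)) \<subseteq> paths G"
    using trivial by (fastforce dest: subsetD[OF keys_sum])
  fix x assume x: "x \<in> paths G"
  show "lin (path_comp G x) (\<Sum>v\<in>verts G. Poly_Mapping.single (v, []) (1::'k)) = Poly_Mapping.single x 1"
  proof -
    have "path_target G x \<in> verts G"
      using awalk_path_target[OF x] by auto
    then show ?thesis
      by (simp add: lin_sum path_comp_def)
  qed
  show "lin (\<lambda>w. path_comp G w x) (\<Sum>v\<in>verts G. Poly_Mapping.single (v, []) (1::'k)) = Poly_Mapping.single x 1"
  proof -
    have "(\<Sum>v\<in>verts G. path_comp G (v, []) x) = (\<Sum>v\<in>verts G. if v = fst x then Poly_Mapping.single x (1::'k) else 0)"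
      using trivial by (intro sum.cong) (auto simp: path_comp_def)
    moreover have "fst x \<in> verts G"
      using awalk_path_target[OF x] by auto
    ultimately show ?thesis
      by (simp add: lin_sum)
  qed
qed (auto simp: path_comp_def paths_append_iff path_target_append)

lemma free_algebra_eq:
  "free_algebra G = \<lparr>carrier = {f. Poly_Mapping.keys f \<subseteq> lists G},
     monoid.mult = bilin (\<lambda>u w. Poly_Mapping.single (u @ w) 1),
     one = Poly_Mapping.single [] 1, ring.zero = 0, ring.add = (+)\<rparr>"
proof -
  have "(\<lambda>f g. \<Sum>u\<in>Poly_Mapping.keys f. \<Sum>w\<in>Poly_Mapping.keys g.
       Poly_Mapping.single (u @ w) (Poly_Mapping.lookup f u * Poly_Mapping.lookup g w))
     = bilin (\<lambda>u w. Poly_Mapping.single (u @ w) 1)"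
    by (intro ext) (auto simp: bilin_def lin_def pm.scale_sum_right intro!: sum.cong)
  then show ?thesis
    unfolding free_algebra_def by simp
qed

lemma ring_free_algebra: "ring (free_algebra G)"
  unfolding free_algebra_eq by (rule ring_bilin) auto

section \<open>The action on ghost paths\<close>

text \<open>\<open>None\<close> encodes the zero vector. The rules send a ghost path to a ghost path
  or to zero, so words can act by partial maps on paths, composed by
  \<open>Option.bind\<close>.\<close>

definition basis_vector :: "'a option \<Rightarrow> ('a \<Rightarrow>\<^sub>0 'k::field)"
  where "basis_vector x = (case x of None \<Rightarrow> 0 | Some y \<Rightarrow> Poly_Mapping.single y 1)"

lemma basis_vector_simps [simp]:
  "basis_vector None = 0" "basis_vector (Some y) = Poly_Mapping.single y 1"
  by (simp_all add: basis_vector_def)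

lemma fin_digraph_inverse_quiver: "fin_digraph G \<Longrightarrow> fin_digraph (inverse_quiver G)"
  unfolding fin_digraph_def fin_digraph_axioms_def wf_digraph_def inverse_quiver_def by simp

lemma path_target_Nil [simp]: "path_target H (u, []) = u"
  by (simp add: path_target_def pre_digraph.awalk_verts.simps)

lemma path_target_snoc [simp]: "path_target H (u, p @ [e]) = head H e"
  by (simp add: path_target_def pre_digraph.awalk_verts_conv)

lemma (in wf_digraph) Nil_in_paths_iff [simp]: "(u, []) \<in> paths G \<longleftrightarrow> u \<in> verts G"
  by (auto simp: paths_def awalk_Nil_iff)

lemma (in wf_digraph) singleton_in_paths_iff: "(u, [e]) \<in> paths G \<longleftrightarrow> e \<in> arcs G \<and> u = tail G e"
  by (auto simp: paths_def awalk_simps)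

lemma (in wf_digraph) path_target_in_verts: "d \<in> paths G \<Longrightarrow> path_target G d \<in> verts G"
  using awalk_path_target[of d] by (rule awalk_last_in_verts)

lemma (in wf_digraph) fst_in_verts: "d \<in> paths G \<Longrightarrow> fst d \<in> verts G"
  using awalk_path_target[of d] by (rule awalk_hd_in_verts)

text \<open>
  A path \<open>d\<close> of the inverse quiver is a ghost path in the Leavitt path algebra; \<open>ghost_step G g d\<close>
  is the product \<open>d g\<close> with a generator. The product of a trivial path with an arrow is not a ghost
  path; the value \<open>None\<close> is only correct if this path is based at a sink.
\<close>

fun ghost_step ::
  "('v, 'e) pre_digraph \<Rightarrow> ('v, 'e) leavitt_gen \<Rightarrow> ('v, 'e) path \<Rightarrow> ('v, 'e) path option"
  where
    "ghost_step G (Vertex v) d = (if v = path_target (inverse_quiver G) d then Some d else None)"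
  | "ghost_step G (Ghost e) d =
      (if head G e = path_target (inverse_quiver G) d then Some (fst d, snd d @ [e]) else None)"
  | "ghost_step G (Arrow e) d =
      (if snd d \<noteq> [] \<and> last (snd d) = e then Some (fst d, butlast (snd d)) else None)"

fun ghost_act ::
  "('v, 'e) pre_digraph \<Rightarrow> ('v, 'e) leavitt_gen list \<Rightarrow> ('v, 'e) path \<Rightarrow> ('v, 'e) path option"
  where
    "ghost_act G [] d = Some d"
  | "ghost_act G (g # w) d = Option.bind (ghost_step G g d) (ghost_act G w)"

lemma ghost_act_append: "ghost_act G (u @ w) d = Option.bind (ghost_act G u d) (ghost_act G w)"
proof (induction u arbitrary: d)
  case (Cons g u)
  then show ?case by (cases "ghost_step G g d") auto
qed simp

text \<open>A candidate for the product d f in L(E). It can differ from this product when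
  \<open>d\<close> has fewer arrows than the words of \<open>f\<close> remove.\<close>

definition reduce ::
  "('v, 'e) pre_digraph \<Rightarrow> ('v, 'e) path \<Rightarrow> (('v, 'e) leavitt_gen list \<Rightarrow>\<^sub>0 'k::field)
    \<Rightarrow> (('v, 'e) path \<Rightarrow>\<^sub>0 'k)"
  where "reduce G d = lin (\<lambda>w. basis_vector (ghost_act G w d))"

lemma reduce_single [simp]:
  "reduce G d (Poly_Mapping.single w a) = pm_scale a (basis_vector (ghost_act G w d))"
  by (simp add: reduce_def)

lemmas reduce_linear = lin_add[of "\<lambda>w. basis_vector (ghost_act G w d)" for G d, folded reduce_def]
  lin_diff[of "\<lambda>w. basis_vector (ghost_act G w d)" for G d, folded reduce_def]
  lin_uminus[of "\<lambda>w. basis_vector (ghost_act G w d)" for G d, folded reduce_def]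
  lin_sum[of "\<lambda>w. basis_vector (ghost_act G w d)" for G d, folded reduce_def]

lemma reduce_zero [simp]: "reduce G d 0 = 0"
  by (simp add: reduce_def)

abbreviation word :: "'g list \<Rightarrow> ('g list \<Rightarrow>\<^sub>0 'k::field)"
  where "word w \<equiv> Poly_Mapping.single w 1"

abbreviation word_mult :: "('g list \<Rightarrow>\<^sub>0 'k) \<Rightarrow> ('g list \<Rightarrow>\<^sub>0 'k) \<Rightarrow> ('g list \<Rightarrow>\<^sub>0 'k::field)"
  where "word_mult \<equiv> bilin (\<lambda>u w. word (u @ w))"

text \<open>This is a right action: letters act in reading order, so the left factor acts
  first.\<close>

lemma reduce_word_mult: "reduce G d (word_mult f g) = lin (\<lambda>d'. reduce G d' g) (reduce G d f)"
proof -
  have "lin (\<lambda>w. basis_vector (ghost_act G (u @ w) d)) g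
      = lin (\<lambda>d'. reduce G d' g) (basis_vector (ghost_act G u d))" for u
    by (cases "ghost_act G u d") (auto simp: ghost_act_append reduce_def)
  then show ?thesis
    unfolding reduce_def bilin_def lin_lin by (simp add: reduce_def)
qed

text \<open>A ghost path \<open>d\<close> of depth \<open>n\<close> absorbs \<open>n\<close> arrows without leaving the ghost paths.\<close>

definition deep :: "('v, 'e) pre_digraph \<Rightarrow> nat \<Rightarrow> ('v, 'e) path set"
  where "deep G n = {d \<in> paths (inverse_quiver G). n \<le> length (snd d) \<or> out_arcs G (fst d) = {}}"

lemma deep_mono: "\<lbrakk>d \<in> deep G n; m \<le> n\<rbrakk> \<Longrightarrow> d \<in> deep G m"
  unfolding deep_def by auto

lemma leavitt_relation_cases [consumes 1, case_names vertices unit tail_arrow arrow_head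
    head_ghost ghost_tail ghost_arrow cuntz_krieger]:
  assumes "r \<in> leavitt_relations E"
  obtains v v' where "r = word [Vertex v, Vertex v'] - (if v = v' then word [Vertex v] else 0)"
      "v \<in> verts E" "v' \<in> verts E"
    | "r = (\<Sum>v\<in>verts E. word [Vertex v]) - word []"
    | e where "r = word [Vertex (tail E e), Arrow e] - word [Arrow e]" "e \<in> arcs E"
    | e where "r = word [Arrow e, Vertex (head E e)] - word [Arrow e]" "e \<in> arcs E"
    | e where "r = word [Vertex (head E e), Ghost e] - word [Ghost e]" "e \<in> arcs E"
    | e where "r = word [Ghost e, Vertex (tail E e)] - word [Ghost e]" "e \<in> arcs E"
    | e e' where "r = word [Ghost e, Arrow e'] - (if e = e' then word [Vertex (head E e)] else 0)"
      "e \<in> arcs E" "e' \<in> arcs E"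
    | v where "r = word [Vertex v] - (\<Sum>e\<in>out_arcs E v. word [Arrow e, Ghost e])"
      "v \<in> verts E" "out_arcs E v \<noteq> {}"
  using assms unfolding leavitt_relations_def Let_def
  by (elim UnE CollectE exE conjE singletonE)
    ((rule that(1), assumption+)[1], (rule that(2), assumption+)[1], (rule that(3), assumption+)[1],
      (rule that(4), assumption+)[1], (rule that(5), assumption+)[1], (rule that(6), assumption+)[1],
      (rule that(7), assumption+)[1], (rule that(8), assumption+)[1])

text \<open>A lift of \<open>ghost_embedding\<close> to the free algebra. It is multiplicative only
  modulo the relations, because every \<open>path_word\<close> brings its own vertex letter.\<close>

definition ghost_word_map :: "(('v, 'e) path \<Rightarrow>\<^sub>0 'k::field) \<Rightarrow> (('v, 'e) leavitt_gen list \<Rightarrow>\<^sub>0 'k)"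
  where "ghost_word_map = lin (\<lambda>d. word (path_word d))"

text \<open>In this form a relation is applied inside a longer word: \<open>u\<close> and
  \<open>v\<close> are the letters before and after the place of use.\<close>

definition sandwich :: "'g list \<Rightarrow> ('g list \<Rightarrow>\<^sub>0 'k::field) \<Rightarrow> 'g list \<Rightarrow> ('g list \<Rightarrow>\<^sub>0 'k)"
  where "sandwich u f v = lin (\<lambda>w. word (u @ w @ v)) f"

lemma sandwich_eq_mult: "sandwich u f v = word_mult (word_mult (word u) f) (word v)"
  by (simp add: sandwich_def bilin_def lin_lin)

lemma sandwich_linear:
  "sandwich u (f - g) v = sandwich u f v - sandwich u g v"
  "sandwich u (\<Sum>i\<in>S. h i) v = (\<Sum>i\<in>S. sandwich u (h i) v)"
  by (simp_all add: sandwich_def lin_diff lin_sum)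

lemma sandwich_simps [simp]: "sandwich u (word w) v = word (u @ w @ v)" "sandwich u 0 v = 0"
  by (simp_all add: sandwich_def)

lemma ghost_word_map_simps [simp]:
  "ghost_word_map (Poly_Mapping.single d a) = Poly_Mapping.single (path_word d) a"
  "ghost_word_map 0 = 0"
  by (simp_all add: ghost_word_map_def)

text \<open>A pair \<open>d\<close> encodes a path \<gamma> of E through its reverse. Hence
  \<open>fst d\<close> is the end of \<gamma>, and lengthening \<gamma> at its end prepends an arrow
  to the list.\<close>

definition extensions :: "('v, 'e) pre_digraph \<Rightarrow> ('v, 'e) path \<Rightarrow> ('v, 'e) path set"
  where "extensions G d = (if out_arcs G (fst d) = {} then {d}
    else (\<lambda>e. (head G e, e # snd d)) ` out_arcs G (fst d))"

primrec level :: "('v, 'e) pre_digraph \<Rightarrow> nat \<Rightarrow> ('v, 'e) path set"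
  where
    "level G 0 = (\<lambda>v. (v, [])) ` verts G"
  | "level G (Suc n) = (\<Union>d\<in>level G n. extensions G d)"

text \<open>The path \<gamma> whose reverse is \<open>d\<close>. It carries no vertex letter of its
  own: in \<open>real_word d @ path_word d\<close> the letter between the two halves marks the place
  where an extension inserts an arrow and its ghost.\<close>

definition real_word :: "('v, 'e) path \<Rightarrow> ('v, 'e) leavitt_gen list"
  where "real_word d = map Arrow (rev (snd d))"

context fin_digraph
begin

abbreviation "H \<equiv> inverse_quiver G"

lemma inverse_quiver_simps [simp]:
  "verts H = verts G" "arcs H = arcs G" "tail H = head G" "head H = tail G"
  by (simp_all add: inverse_quiver_def)

interpretation H: fin_digraph H
  by (rule fin_digraph_inverse_quiver) unfold_locales

section \<open>Ghost paths and their depth under the generators\<close>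

lemma snoc_in_ghost_paths_iff:
  "(u, p @ [e]) \<in> paths H \<longleftrightarrow> (u, p) \<in> paths H \<and> e \<in> arcs G \<and> head G e = path_target H (u, p)"
  unfolding H.paths_append_iff H.singleton_in_paths_iff by auto

lemma Cons_in_ghost_paths_iff:
  "(u, e # p) \<in> paths H \<longleftrightarrow> e \<in> arcs G \<and> u = head G e \<and> (tail G e, p) \<in> paths H"
  using H.paths_append_iff[of u "[e]" p] path_target_snoc[of H u "[]" e]
  by (auto simp: H.singleton_in_paths_iff)

lemma ghost_step_in_paths:
  assumes "ghost_step G g d = Some d'" "g \<in> leavitt_gens G" "d \<in> paths H"
  shows "d' \<in> paths H"
proof -
  obtain u p where d: "d = (u, p)" by (cases d)
  show ?thesis
  proof (cases g)
    case (Arrow e)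
    then obtain p' where "p = p' @ [e]" "d' = (u, p')"
      using assms(1) unfolding d by (cases p rule: rev_cases) (auto split: if_splits)
    then show ?thesis
      using assms(3) d by (simp add: snoc_in_ghost_paths_iff)
  qed (use assms d in \<open>auto simp: snoc_in_ghost_paths_iff leavitt_gens_def split: if_splits\<close>)
qed

text \<open>Only an arrow shortens a ghost path, and by one ghost. No generator changes
  \<open>fst d\<close>, so the alternative that \<open>fst d\<close> is a sink survives at any
  length.\<close>

lemma ghost_step_deep:
  assumes "ghost_step G g d = Some d'" "g \<in> leavitt_gens G" "d \<in> deep G (Suc n)"
  shows "d' \<in> deep G n"
proof -
  have "fst d' = fst d" "length (snd d) \<le> Suc (length (snd d'))"
    using assms(1) by (cases g; auto split: if_splits)+
  then show ?thesis
    using assms(3) ghost_step_in_paths[OF assms(1,2)] unfolding deep_def by auto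
qed

lemma ghost_act_in_paths:
  "\<lbrakk>ghost_act G w d = Some d'; w \<in> lists (leavitt_gens G); d \<in> paths H\<rbrakk> \<Longrightarrow> d' \<in> paths H"
proof (induction w arbitrary: d)
  case (Cons g w)
  then show ?case
    using ghost_step_in_paths[of g d] by (cases "ghost_step G g d") auto
qed simp

lemma ghost_act_deep:
  "\<lbrakk>ghost_act G w d = Some d'; w \<in> lists (leavitt_gens G); d \<in> deep G (length w + n)\<rbrakk>
    \<Longrightarrow> d' \<in> deep G n"
proof (induction w arbitrary: d)
  case (Cons g w)
  then show ?case
    using ghost_step_deep[of g d] by (cases "ghost_step G g d") auto
qed simp

lemma keys_reduce:
  assumes "Poly_Mapping.keys f \<subseteq> lists (leavitt_gens G)" "d \<in> paths H"
  shows "Poly_Mapping.keys (reduce G d f) \<subseteq> paths H"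
proof -
  have "Poly_Mapping.keys (basis_vector (ghost_act G w d) :: _ \<Rightarrow>\<^sub>0 'c::field) \<subseteq> paths H"
    if "w \<in> Poly_Mapping.keys f" for w
    using ghost_act_in_paths[of w d] that assms by (cases "ghost_act G w d") auto
  then show ?thesis
    unfolding reduce_def by (intro subset_trans[OF keys_lin]) auto
qed

lemma ghost_act_ghosts:
  "(path_target H d, p) \<in> paths H \<Longrightarrow> ghost_act G (map Ghost p) d = Some (fst d, snd d @ p)"
proof (induction p arbitrary: d)
  case (Cons e p)
  then have e: "head G e = path_target H d" "(tail G e, p) \<in> paths H"
    by (auto simp: Cons_in_ghost_paths_iff)
  then show ?case
    using Cons.IH[of "(fst d, snd d @ [e])"] by simp
qed simp

text \<open>The leading vertex letter tests whether \<open>d\<close> and \<open>x\<close> compose;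
  the ghosts are then appended one by one.\<close>

lemma ghost_act_path_word:
  assumes "x \<in> paths H"
  shows "basis_vector (ghost_act G (path_word x) d) = path_comp H d x"
  using assms ghost_act_ghosts[of d "snd x"] by (auto simp: path_word_def path_comp_def)

text \<open>Depth 1 is dictated by the relation p_v = \<Sum> e \<bar>e: on the trivial path at a
  vertex \<open>v\<close> that emits arrows, the words \<open>[Arrow e, Ghost e]\<close> act as zero
  while \<open>Vertex v\<close> acts as the identity.\<close>

lemma reduce_relation:
  assumes d: "d \<in> deep G 1" and r: "r \<in> leavitt_relations G"
  shows "reduce G d r = (0 :: ('a, 'b) path \<Rightarrow>\<^sub>0 'k::field)"
proof -
  obtain u p where up: "d = (u, p)" by (cases d)
  have d': "(u, p) \<in> paths H" and sink: "p = [] \<Longrightarrow> out_arcs G u = {}"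
    using d unfolding deep_def up by auto
  have target: "path_target H d \<in> verts G"
    using H.path_target_in_verts[of d] d' up by simp
  consider (Nil) "p = []" | (snoc) p' e where "p = p' @ [e]" "(u, p') \<in> paths H" "e \<in> arcs G"
      "head G e = path_target H (u, p')" "path_target H d = tail G e"
    using d' up by (cases p rule: rev_cases) (auto simp: snoc_in_ghost_paths_iff)
  note cases = this
  have vertex_sum: "reduce G d (\<Sum>v\<in>verts G. Poly_Mapping.single [Vertex v] (1::'k)) = Poly_Mapping.single d 1"
  proof -
    have "reduce G d (\<Sum>v\<in>verts G. Poly_Mapping.single [Vertex v] (1::'k))
        = (\<Sum>v\<in>verts G. if v = path_target H d then Poly_Mapping.single d 1 else 0)"
      unfolding reduce_linear by (intro sum.cong) auto
    then show ?thesis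
      using target by simp
  qed
  have arrow_sum: "reduce G d (\<Sum>e\<in>out_arcs G v. Poly_Mapping.single [Arrow e, Ghost e] (1::'k))
      = reduce G d (Poly_Mapping.single [Vertex v] 1)" if v: "out_arcs G v \<noteq> {}" for v
    using cases
  proof cases
    case Nil
    \<comment> \<open>Depth 1 places a trivial \<open>d\<close> at a sink, whereas \<open>v\<close>
      emits arrows; both sides vanish.\<close>
    then have "v \<noteq> u"
      using v sink by auto
    then show ?thesis
      using Nil up by (simp add: reduce_linear)
  next
    case (snoc p' e)
    \<comment> \<open>Only the last arrow of \<open>d\<close> can act nontrivially: it removes the
      last ghost, and the ghost letter after it restores this ghost.\<close>
    have "reduce G d (\<Sum>e\<in>out_arcs G v. Poly_Mapping.single [Arrow e, Ghost e] (1::'k))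
        = (\<Sum>e'\<in>out_arcs G v. if e' = e then Poly_Mapping.single d 1 else 0)"
      unfolding reduce_linear using snoc up by (intro sum.cong) auto
    also have "\<dots> = (if tail G e = v then Poly_Mapping.single d 1 else 0)"
      using snoc(3) by (simp add: out_arcs_def)
    finally show ?thesis
      using snoc(5) by auto
  qed
  have arrow: "reduce G d (Poly_Mapping.single [Vertex (tail G e), Arrow e] (1::'k))
        = reduce G d (Poly_Mapping.single [Arrow e] 1)"
      "reduce G d (Poly_Mapping.single [Arrow e, Vertex (head G e)] (1::'k))
        = reduce G d (Poly_Mapping.single [Arrow e] 1)" for e
    using cases by (cases; auto simp: up)+
  from r show ?thesis
  proof (cases rule: leavitt_relation_cases)
    case (vertices v v')
    then show ?thesis by (auto simp: reduce_linear)
  next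
    case unit
    then show ?thesis by (simp add: reduce_linear(2) vertex_sum)
  next
    case (cuntz_krieger v)
    show ?thesis
      unfolding cuntz_krieger(1) reduce_linear(2) arrow_sum[OF cuntz_krieger(3)] by (rule diff_self)
  next
    case (tail_arrow e)
    show ?thesis unfolding tail_arrow(1) reduce_linear(2) arrow by (rule diff_self)
  next
    case (arrow_head e)
    show ?thesis unfolding arrow_head(1) reduce_linear(2) arrow by (rule diff_self)
  qed (auto simp: reduce_linear)
qed

section \<open>The Leavitt ideal and its vanishing on deep ghost paths\<close>

lemma ring_A: "ring (free_algebra (leavitt_gens G))"
  by (rule ring_free_algebra)

lemma leavitt_relations_subset:
  "(leavitt_relations G :: (('a, 'b) leavitt_gen list \<Rightarrow>\<^sub>0 'k::field) set)
    \<subseteq> carrier (free_algebra (leavitt_gens G))"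
proof -
  let ?L = "lists (leavitt_gens G)"
  have gens: "v \<in> verts G \<Longrightarrow> Vertex v \<in> leavitt_gens G" "e \<in> arcs G \<Longrightarrow> Arrow e \<in> leavitt_gens G"
    "e \<in> arcs G \<Longrightarrow> Ghost e \<in> leavitt_gens G" for v e
    by (auto simp: leavitt_gens_def)
  have diff: "Poly_Mapping.keys (f - g) \<subseteq> ?L"
    if "Poly_Mapping.keys f \<subseteq> ?L" "Poly_Mapping.keys g \<subseteq> ?L" for f g :: "_ \<Rightarrow>\<^sub>0 'k"
    using that by (intro subset_trans[OF keys_diff]) auto
  have sum: "Poly_Mapping.keys (\<Sum>i\<in>S. f i) \<subseteq> ?L"
    if "\<And>i. i \<in> S \<Longrightarrow> Poly_Mapping.keys (f i) \<subseteq> ?L" for f :: "'z \<Rightarrow> _ \<Rightarrow>\<^sub>0 'k" and S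
    using that by (intro subset_trans[OF keys_sum]) auto
  have "Poly_Mapping.keys r \<subseteq> ?L" if "r \<in> leavitt_relations G" for r :: "_ \<Rightarrow>\<^sub>0 'k"
    using that
  proof (cases rule: leavitt_relation_cases)
    case (vertices v v')
    show ?thesis
      unfolding vertices(1) by (intro diff sum) (use vertices in \<open>auto simp: gens\<close>)
  next
    case unit
    show ?thesis
      unfolding unit by (intro diff sum) (use unit in \<open>auto simp: gens\<close>)
  next
    case (tail_arrow e)
    show ?thesis
      unfolding tail_arrow(1) by (intro diff sum) (use tail_arrow in \<open>auto simp: gens\<close>)
  next
    case (arrow_head e)
    show ?thesis
      unfolding arrow_head(1) by (intro diff sum) (use arrow_head in \<open>auto simp: gens\<close>)
  next
    case (head_ghost e)
    show ?thesis
      unfolding head_ghost(1) by (intro diff sum) (use head_ghost in \<open>auto simp: gens\<close>)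
  next
    case (ghost_tail e)
    show ?thesis
      unfolding ghost_tail(1) by (intro diff sum) (use ghost_tail in \<open>auto simp: gens\<close>)
  next
    case (ghost_arrow e e')
    show ?thesis
      unfolding ghost_arrow(1) by (intro diff sum) (use ghost_arrow in \<open>auto simp: gens\<close>)
  next
    case (cuntz_krieger v)
    show ?thesis
      unfolding cuntz_krieger(1) by (intro diff sum) (use cuntz_krieger in \<open>auto simp: gens\<close>)
  qed
  then show ?thesis
    by (auto simp: free_algebra_def)
qed

abbreviation "A \<equiv> free_algebra (leavitt_gens G)"
abbreviation "I \<equiv> leavitt_ideal G"

lemma gens [simp]:
  "v \<in> verts G \<Longrightarrow> Vertex v \<in> leavitt_gens G"
  "e \<in> arcs G \<Longrightarrow> Arrow e \<in> leavitt_gens G"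
  "e \<in> arcs G \<Longrightarrow> Ghost e \<in> leavitt_gens G"
  by (auto simp: leavitt_gens_def)

lemma A_simps:
  "carrier A = {f. Poly_Mapping.keys f \<subseteq> lists (leavitt_gens G)}"
  "f \<otimes>\<^bsub>A\<^esub> g = word_mult f g" "\<one>\<^bsub>A\<^esub> = word []" "\<zero>\<^bsub>A\<^esub> = 0" "f \<oplus>\<^bsub>A\<^esub> g = f + g"
  by (simp_all add: free_algebra_eq)

lemma word_in_A [simp]: "w \<in> lists (leavitt_gens G) \<Longrightarrow> word w \<in> carrier A"
  by (auto simp: A_simps)

lemma uminus_in_A: "f \<in> carrier A \<Longrightarrow> - f \<in> carrier A"
  by (simp add: A_simps)

lemma a_inv_A: "f \<in> carrier A \<Longrightarrow> \<ominus>\<^bsub>A\<^esub> f = - f"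
  using uminus_in_A[of f]
  by (intro abelian_group.minus_equality[OF ring.is_abelian_group[OF ring_A]]) (auto simp: A_simps)

lemma ideal_I: "ideal I A"
  unfolding leavitt_ideal_def by (rule ring.genideal_ideal[OF ring_A leavitt_relations_subset])

lemma relation_in_I: "r \<in> leavitt_relations G \<Longrightarrow> r \<in> I"
  unfolding leavitt_ideal_def using ring.genideal_self[OF ring_A leavitt_relations_subset] by (rule subsetD)

lemma keys_reduce_deep:
  assumes "Poly_Mapping.keys f \<subseteq> lists (leavitt_gens G)" "d \<in> deep G (m + n)"
    and m: "\<And>w. w \<in> Poly_Mapping.keys f \<Longrightarrow> length w \<le> m"
  shows "Poly_Mapping.keys (reduce G d f) \<subseteq> deep G n"
proof -
  have "Poly_Mapping.keys (basis_vector (ghost_act G w d) :: _ \<Rightarrow>\<^sub>0 'c::field) \<subseteq> deep G n"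
    if w: "w \<in> Poly_Mapping.keys f" for w
  proof (cases "ghost_act G w d")
    case (Some d')
    have "d \<in> deep G (length w + n)"
      using deep_mono[OF assms(2)] m[OF w] by simp
    then show ?thesis
      using ghost_act_deep[OF Some] w assms(1) Some by auto
  qed simp
  then show ?thesis
    unfolding reduce_def by (intro subset_trans[OF keys_lin]) auto
qed

lemma bounded_word_length: "\<exists>m. \<forall>w\<in>Poly_Mapping.keys f. length w \<le> m"
  using finite_nat_set_iff_bounded_le[of "length ` Poly_Mapping.keys f"] by auto

text \<open>The elements that kill all sufficiently deep ghost paths form an ideal \<open>J\<close>.
  It contains the relations, by depth 1, and therefore the ideal they generate.\<close>

lemma reduce_I:
  assumes "f \<in> I"
  shows "\<exists>n. \<forall>d\<in>deep G n. reduce G d f = (0 :: ('a, 'b) path \<Rightarrow>\<^sub>0 'k::field)"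
proof -
  define J :: "(('a, 'b) leavitt_gen list \<Rightarrow>\<^sub>0 'k) set"
    where "J = {f \<in> carrier A. \<exists>n. \<forall>d\<in>deep G n. reduce G d f = 0}"
  have "ideal J A"
  proof (rule idealI[OF ring_A])
    show "subgroup J (add_monoid A)"
    proof (rule subgroup.intro)
      fix f g assume "f \<in> J" "g \<in> J"
      then obtain m n where mn: "\<forall>d\<in>deep G m. reduce G d f = 0" "\<forall>d\<in>deep G n. reduce G d g = 0"
        and fg: "f \<in> carrier A" "g \<in> carrier A"
        by (auto simp: J_def)
      have "reduce G d (f + g) = 0" if "d \<in> deep G (max m n)" for d
        using mn deep_mono[OF that, of m] deep_mono[OF that, of n] by (simp add: reduce_linear)
      then have "\<forall>d\<in>deep G (max m n). reduce G d (f + g) = 0"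
        by blast
      moreover have "f + g \<in> carrier A"
        using ring.ring_simprules(1)[OF ring_A fg] by (simp add: A_simps)
      ultimately show "f \<otimes>\<^bsub>add_monoid A\<^esub> g \<in> J"
        unfolding J_def by (auto simp only: A_simps(5) monoid.simps)
    next
      fix f assume f: "f \<in> J"
      then have "- f \<in> J"
        by (auto simp: J_def uminus_in_A reduce_linear)
      then show "inv\<^bsub>add_monoid A\<^esub> f \<in> J"
        using f a_inv_A[of f] by (simp add: J_def a_inv_def)
    qed (auto simp: J_def A_simps)
  next
    fix f g :: "('a, 'b) leavitt_gen list \<Rightarrow>\<^sub>0 'k" assume f: "f \<in> J" and g: "g \<in> carrier A"
    from f obtain n where n: "\<forall>d\<in>deep G n. reduce G d f = 0" and fA: "f \<in> carrier A"
      by (auto simp: J_def)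
    obtain m where m: "\<forall>w\<in>Poly_Mapping.keys g. length w \<le> m"
      using bounded_word_length by metis
    \<comment> \<open>The factor \<open>g\<close> acts first and may use up depth \<open>m\<close>;
      depth \<open>n\<close> must remain for \<open>f\<close>.\<close>
    have "reduce G d (word_mult g f) = 0" if "d \<in> deep G (m + n)" for d
    proof -
      have "Poly_Mapping.keys (reduce G d g) \<subseteq> deep G n"
        using g that m by (intro keys_reduce_deep) (auto simp: A_simps)
      then have "lin (\<lambda>d'. reduce G d' f) (reduce G d g) = lin (\<lambda>d'. 0) (reduce G d g)"
        using n by (intro lin_cong) auto
      then show ?thesis
        by (simp add: reduce_word_mult)
    qed
    then have "\<forall>d\<in>deep G (m + n). reduce G d (g \<otimes>\<^bsub>A\<^esub> f) = 0"
      by (simp add: A_simps)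
    then show "g \<otimes>\<^bsub>A\<^esub> f \<in> J"
      using ring.ring_simprules(5)[OF ring_A g fA] unfolding J_def by blast
    \<comment> \<open>Here \<open>f\<close> acts first and already gives zero, so the depth stays
      the same.\<close>
    have "\<forall>d\<in>deep G n. reduce G d (f \<otimes>\<^bsub>A\<^esub> g) = 0"
      using n by (simp add: A_simps reduce_word_mult)
    then show "f \<otimes>\<^bsub>A\<^esub> g \<in> J"
      using ring.ring_simprules(5)[OF ring_A fA g] unfolding J_def by blast
  qed
  moreover have "leavitt_relations G \<subseteq> J"
    using leavitt_relations_subset reduce_relation unfolding J_def by blast
  ultimately have "I \<subseteq> J"
    unfolding leavitt_ideal_def by (rule ring.genideal_minimal[OF ring_A])
  then show ?thesis
    using assms unfolding J_def by blast
qed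

section \<open>Congruence modulo the Leavitt ideal\<close>

lemma pm_scale_eq_mult: "pm_scale c f = word_mult (Poly_Mapping.single [] c) f"
  by (simp add: bilin_def)

lemma subspace_I: "pm.subspace (I :: (('a, 'b) leavitt_gen list \<Rightarrow>\<^sub>0 'k::field) set)"
proof (rule pm.subspaceI)
  show "(0 :: ('a, 'b) leavitt_gen list \<Rightarrow>\<^sub>0 'k) \<in> I"
    using additive_subgroup.zero_closed[OF ideal.axioms(1)[OF ideal_I]] by (simp only: A_simps(4))
  show "f + g \<in> I" if "f \<in> I" "g \<in> I" for f g :: "('a, 'b) leavitt_gen list \<Rightarrow>\<^sub>0 'k"
    using additive_subgroup.a_closed[OF ideal.axioms(1)[OF ideal_I] that] by (simp only: A_simps(5))
  show "pm_scale c f \<in> I" if "f \<in> I" for c :: 'k and f :: "('a, 'b) leavitt_gen list \<Rightarrow>\<^sub>0 'k"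
  proof -
    have "Poly_Mapping.single [] c \<in> carrier A"
      by (auto simp: A_simps)
    from ideal.I_l_closed[OF ideal_I that this] show ?thesis
      by (simp only: A_simps(2) pm_scale_eq_mult)
  qed
qed

text \<open>Equality in L(E), expressed on representatives: calculations stay with words and sums
  and can be chained by transitivity.\<close>

definition leavitt_eq ::
  "(('a, 'b) leavitt_gen list \<Rightarrow>\<^sub>0 'k::field) \<Rightarrow> (('a, 'b) leavitt_gen list \<Rightarrow>\<^sub>0 'k) \<Rightarrow> bool"
  (infix \<open>\<doteq>\<close> 50) where "f \<doteq> g \<longleftrightarrow> f - g \<in> I"

lemma leavitt_eq_refl [simp]: "f \<doteq> f"
  using pm.subspace_0[OF subspace_I] by (simp add: leavitt_eq_def)

lemma leavitt_eq_sym: "f \<doteq> g \<Longrightarrow> g \<doteq> f"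
  using pm.subspace_neg[OF subspace_I, of "f - g"] by (simp add: leavitt_eq_def)

lemma leavitt_eq_trans [trans]: "f \<doteq> g \<Longrightarrow> g \<doteq> h \<Longrightarrow> f \<doteq> h"
  using pm.subspace_add[OF subspace_I, of "f - g" "g - h"] by (simp add: leavitt_eq_def)

lemma leavitt_eq_sum: "(\<And>i. i \<in> S \<Longrightarrow> f i \<doteq> g i) \<Longrightarrow> (\<Sum>i\<in>S. f i) \<doteq> (\<Sum>i\<in>S. g i)"
  using pm.subspace_sum[OF subspace_I, of S "\<lambda>i. f i - g i"]
  by (simp add: leavitt_eq_def sum_subtractf)

lemma leavitt_eq_lin:
  "(\<And>x. x \<in> Poly_Mapping.keys f \<Longrightarrow> T x \<doteq> T' x) \<Longrightarrow> lin T f \<doteq> lin T' f"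
  using lin_in_subspace[OF subspace_I, of f "\<lambda>x. T x - T' x"]
  by (simp add: leavitt_eq_def lin_fun_diff)

lemma leavitt_eq_sandwich:
  assumes "f \<doteq> g" "u \<in> lists (leavitt_gens G)" "v \<in> lists (leavitt_gens G)"
  shows "sandwich u f v \<doteq> sandwich u g v"
proof -
  interpret ideal I A by (rule ideal_I)
  have "word u \<otimes>\<^bsub>A\<^esub> (f - g) \<otimes>\<^bsub>A\<^esub> word v \<in> I"
    using assms unfolding leavitt_eq_def by (intro I_l_closed I_r_closed word_in_A)
  then have "sandwich u (f - g) v \<in> I"
    by (simp only: A_simps(2) sandwich_eq_mult)
  then show ?thesis
    by (simp only: leavitt_eq_def sandwich_linear(1))
qed

lemma leavitt_eq_relations:
  "\<lbrakk>v \<in> verts G; v' \<in> verts G\<rbrakk> \<Longrightarrow>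
    word [Vertex v, Vertex v'] \<doteq> (if v = v' then word [Vertex v] else 0)"
  "(\<Sum>v\<in>verts G. word [Vertex v]) \<doteq> word []"
  "e \<in> arcs G \<Longrightarrow> word [Vertex (tail G e), Arrow e] \<doteq> word [Arrow e]"
  "e \<in> arcs G \<Longrightarrow> word [Arrow e, Vertex (head G e)] \<doteq> word [Arrow e]"
  "e \<in> arcs G \<Longrightarrow> word [Vertex (head G e), Ghost e] \<doteq> word [Ghost e]"
  "e \<in> arcs G \<Longrightarrow> word [Ghost e, Vertex (tail G e)] \<doteq> word [Ghost e]"
  "\<lbrakk>e \<in> arcs G; e' \<in> arcs G\<rbrakk> \<Longrightarrow>
    word [Ghost e, Arrow e'] \<doteq> (if e = e' then word [Vertex (head G e)] else 0)"
  "\<lbrakk>v \<in> verts G; out_arcs G v \<noteq> {}\<rbrakk> \<Longrightarrow>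
    word [Vertex v] \<doteq> (\<Sum>e\<in>out_arcs G v. word [Arrow e, Ghost e])"
  \<comment> \<open>The union in \<open>leavitt_relations\<close> associates to the left, so the
    number of \<open>UnI1\<close> steps selects the family.\<close>
  unfolding leavitt_eq_def
  by (rule_tac [!] relation_in_I, unfold leavitt_relations_def Let_def)
    (((rule UnI1, rule UnI1, rule UnI1, rule UnI1, rule UnI1, rule UnI1, rule UnI1, rule CollectI, rule exI[of _ v], rule exI[of _ v'], simp)[1]),
      ((rule UnI1, rule UnI1, rule UnI1, rule UnI1, rule UnI1, rule UnI1, rule UnI2, simp)[1]),
      ((rule UnI1, rule UnI1, rule UnI1, rule UnI1, rule UnI1, rule UnI2, rule CollectI, rule exI[of _ e], simp)[1]),
      ((rule UnI1, rule UnI1, rule UnI1, rule UnI1, rule UnI2, rule CollectI, rule exI[of _ e], simp)[1]),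
      ((rule UnI1, rule UnI1, rule UnI1, rule UnI2, rule CollectI, rule exI[of _ e], simp)[1]),
      ((rule UnI1, rule UnI1, rule UnI2, rule CollectI, rule exI[of _ e], simp)[1]),
      ((rule UnI1, rule UnI2, rule CollectI, rule exI[of _ e], rule exI[of _ e'], simp)[1]),
      ((rule UnI2, rule CollectI, rule exI[of _ v], simp)[1]))

lemma set_ghost_path: "(u, p) \<in> paths H \<Longrightarrow> set p \<subseteq> arcs G"
  by (induction p arbitrary: u) (auto simp: Cons_in_ghost_paths_iff)

lemma ghost_path_in_lists:
  assumes "d \<in> paths H"
  shows "map Ghost (snd d) \<in> lists (leavitt_gens G)" "map Arrow (rev (snd d)) \<in> lists (leavitt_gens G)"
  using set_ghost_path[of "fst d" "snd d"] assms by (auto intro!: gens)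

lemma path_word_in_lists: "d \<in> paths H \<Longrightarrow> path_word d \<in> lists (leavitt_gens G)"
  using ghost_path_in_lists(1)[of d] H.fst_in_verts[of d] by (simp add: path_word_def)

lemma real_word_in_lists: "d \<in> paths H \<Longrightarrow> real_word d \<in> lists (leavitt_gens G)"
  using ghost_path_in_lists(2)[of d] by (simp add: real_word_def)

text \<open>The last ghost of \<open>d\<close> absorbs the vertex at its tail, so an appended vertex
  meets the target of \<open>d\<close> and orthogonality of the vertices decides.\<close>

lemma path_word_vertex:
  assumes "d \<in> paths H" "v \<in> verts G"
  shows "word (path_word d @ [Vertex v])
    \<doteq> (if v = path_target H d then word (path_word d) else (0 :: ('a, 'b) leavitt_gen list \<Rightarrow>\<^sub>0 'k::field))"
proof -
  obtain u p where d: "d = (u, p)" by (cases d)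
  show ?thesis
  proof (cases p rule: rev_cases)
    case Nil
    then show ?thesis
      using leavitt_eq_relations(1)[of u v] assms H.fst_in_verts[of d] by (auto simp: d path_word_def)
  next
    case (snoc p' e)
    define w where "w = path_word (u, p')"
    have e: "e \<in> arcs G" "(u, p') \<in> paths H" and w: "w \<in> lists (leavitt_gens G)"
      using assms(1) path_word_in_lists[of "(u, p')"] by (auto simp: d snoc snoc_in_ghost_paths_iff w_def)
    have pw: "path_word d = w @ [Ghost e]"
      by (simp add: d snoc w_def path_word_def)
    have 1: "word (w @ [Ghost e, Vertex (tail G e)]) \<doteq> (word (w @ [Ghost e]) :: _ \<Rightarrow>\<^sub>0 'k)"
      using leavitt_eq_sandwich[OF leavitt_eq_relations(6)[OF e(1)] w, of "[]"] by simp
    show ?thesis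
    proof (cases "v = tail G e")
      case True
      then show ?thesis
        using 1 by (simp add: d snoc pw[unfolded d snoc])
    next
      case False
      have "word (w @ [Ghost e] @ [Vertex v]) \<doteq> (word (w @ [Ghost e, Vertex (tail G e)] @ [Vertex v]) :: _ \<Rightarrow>\<^sub>0 'k)"
        using leavitt_eq_sandwich[OF leavitt_eq_sym[OF 1], of "[]" "[Vertex v]"] assms by simp
      also have "\<dots> \<doteq> 0"
        using leavitt_eq_sandwich[OF leavitt_eq_relations(1)[of "tail G e" v], of "w @ [Ghost e]" "[]"]
          False assms e w by simp
      finally show ?thesis
        using False by (simp add: d snoc pw[unfolded d snoc])
    qed
  qed
qed

text \<open>Soundness of \<open>ghost_step\<close> as multiplication in L(E). Depth 1 excludes a
  trivial path followed by an arrow out of its vertex, the one case in which the value is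
  wrong.\<close>

lemma path_word_step:
  assumes "d \<in> deep G 1" "g \<in> leavitt_gens G"
  shows "word (path_word d @ [g])
    \<doteq> ghost_word_map (basis_vector (ghost_step G g d) :: ('a, 'b) path \<Rightarrow>\<^sub>0 'k::field)"
proof -
  obtain u p where d: "d = (u, p)" by (cases d)
  have dp: "d \<in> paths H" and sink: "p = [] \<Longrightarrow> out_arcs G u = {}"
    using assms(1) unfolding deep_def d by auto
  note pw = path_word_in_lists[OF dp]
  show ?thesis
  proof (cases g)
    case (Vertex v)
    then have "v \<in> verts G"
      using assms(2) by (auto simp: leavitt_gens_def)
    then show ?thesis
      using path_word_vertex[OF dp, of v] Vertex by (auto split: if_splits)
  next
    case (Ghost e)
    then have e: "e \<in> arcs G"
      using assms(2) by (auto simp: leavitt_gens_def)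
    show ?thesis
    proof (cases "head G e = path_target H d")
      case True
      then show ?thesis
        using Ghost by (simp add: path_word_def)
    next
      case False
      have "word (path_word d @ [Ghost e]) \<doteq> (word (path_word d @ [Vertex (head G e), Ghost e]) :: _ \<Rightarrow>\<^sub>0 'k)"
        using leavitt_eq_sandwich[OF leavitt_eq_sym[OF leavitt_eq_relations(5)[OF e]] pw, of "[]"] by simp
      also have "\<dots> \<doteq> 0"
        using leavitt_eq_sandwich[OF path_word_vertex[OF dp, of "head G e"], of "[]" "[Ghost e]"] False e
        by simp
      finally show ?thesis
        using False Ghost by simp
    qed
  next
    case (Arrow e)
    then have e: "e \<in> arcs G"
      using assms(2) by (auto simp: leavitt_gens_def)
    show ?thesis
    proof (cases p rule: rev_cases)
      case Nil
      \<comment> \<open>The vertex \<open>u\<close> is a sink, hence not the tail of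
        \<open>e\<close>. Writing e as p_v e with v = \<open>tail G e\<close> makes the product zero
        by orthogonality.\<close>
      have u: "u \<in> verts G" "u \<noteq> tail G e"
        using H.fst_in_verts[OF dp] sink[OF Nil] e by (auto simp: d)
      have "word ([Vertex u] @ [Arrow e]) \<doteq> (word [Vertex u, Vertex (tail G e), Arrow e] :: _ \<Rightarrow>\<^sub>0 'k)"
        using leavitt_eq_sandwich[OF leavitt_eq_sym[OF leavitt_eq_relations(3)[OF e]], of "[Vertex u]" "[]"] u
        by simp
      also have "\<dots> \<doteq> 0"
        using leavitt_eq_sandwich[OF leavitt_eq_relations(1)[of u "tail G e"], of "[]" "[Arrow e]"] u e
        by simp
      finally show ?thesis
        using Arrow Nil by (simp add: d path_word_def)
    next
      case (snoc p' e')
      have e': "e' \<in> arcs G" "(u, p') \<in> paths H" "head G e' = path_target H (u, p')"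
        using dp by (auto simp: d snoc snoc_in_ghost_paths_iff)
      note pw' = path_word_in_lists[OF e'(2)]
      have "word (path_word d @ [g]) = (word (path_word (u, p') @ [Ghost e', Arrow e]) :: _ \<Rightarrow>\<^sub>0 'k)"
        by (simp add: d snoc Arrow path_word_def)
      also have "\<dots> \<doteq> (if e' = e then word (path_word (u, p') @ [Vertex (head G e')]) else 0)"
        using leavitt_eq_sandwich[OF leavitt_eq_relations(7)[OF e'(1) e] pw', of "[]"]
        by (cases "e' = e") simp_all
      also have "\<dots> \<doteq> (if e' = e then word (path_word (u, p')) else 0)"
        using path_word_vertex[OF e'(2) head_in_verts[OF e'(1)]] e'(3) by auto
      also have "\<dots> = ghost_word_map (basis_vector (ghost_step G g d))"
        by (simp add: d snoc Arrow)
      finally show ?thesis .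
    qed
  qed
qed

section \<open>Decomposition of the unit over a level\<close>

lemma level_subset: "d \<in> level G n \<Longrightarrow> d \<in> deep G n \<and> length (snd d) \<le> n"
proof (induction n arbitrary: d)
  case 0
  then show ?case by (auto simp: deep_def)
next
  case (Suc n)
  then obtain c where c: "c \<in> level G n" "d \<in> extensions G c"
    by auto
  show ?case
  proof (cases "out_arcs G (fst c) = {}")
    case True
    then show ?thesis
      using c Suc.IH[of c] by (auto simp: extensions_def deep_def)
  next
    case False
    then show ?thesis
      using c Suc.IH[of c] by (auto simp: extensions_def deep_def Cons_in_ghost_paths_iff)
  qed
qed

lemma level_in_paths: "d \<in> level G n \<Longrightarrow> d \<in> paths H"
  using level_subset by (auto simp: deep_def)

lemma finite_extensions: "finite (extensions G d)"
  by (auto simp: extensions_def)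

lemma finite_level: "finite (level G n)"
  by (induction n) (auto simp: finite_extensions)

text \<open>Paths of a level that do not end at a sink have length exactly \<open>n\<close>. Their
  extensions have length n + 1 and differ from the paths kept, of length at most \<open>n\<close>;
  an extension also determines its parent, whose end is the tail of the new arrow.\<close>

lemma disjoint_extensions:
  assumes "c \<in> level G n" "d \<in> level G n" "c \<noteq> d"
  shows "extensions G c \<inter> extensions G d = {}"
proof -
  have "length (snd c) = n" if "out_arcs G (fst c) \<noteq> {}"
    using level_subset[OF assms(1)] that by (auto simp: deep_def)
  moreover have "length (snd d) = n" if "out_arcs G (fst d) \<noteq> {}"
    using level_subset[OF assms(2)] that by (auto simp: deep_def)
  ultimately show ?thesis
    using level_subset[OF assms(1)] level_subset[OF assms(2)] assms(3)
    by (cases "out_arcs G (fst c) = {}"; cases "out_arcs G (fst d) = {}"; cases c; cases d)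
      (auto simp: extensions_def)
qed

text \<open>The vertex letter between the two halves is replaced by \<Sum> e \<bar>e; the vertex at
  the head of e is then inserted before \<bar>e to restore the form of
  \<open>path_word\<close>.\<close>

lemma word_extension:
  assumes "d \<in> paths H"
  shows "word (real_word d @ path_word d)
    \<doteq> (\<Sum>c\<in>extensions G d. word (real_word c @ path_word c) :: ('a, 'b) leavitt_gen list \<Rightarrow>\<^sub>0 'k::field)"
proof (cases "out_arcs G (fst d) = {}")
  case True
  then show ?thesis by (simp add: extensions_def)
next
  case False
  let ?g = "map Ghost (snd d)"
  have g: "?g \<in> lists (leavitt_gens G)" and u: "fst d \<in> verts G"
    using ghost_path_in_lists(1)[OF assms] H.fst_in_verts[OF assms] by auto
  note r = real_word_in_lists[OF assms]
  have "word (real_word d @ [Vertex (fst d)] @ ?g)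
      \<doteq> (\<Sum>e\<in>out_arcs G (fst d). word (real_word d @ [Arrow e, Ghost e] @ ?g) :: _ \<Rightarrow>\<^sub>0 'k)"
    using leavitt_eq_sandwich[OF leavitt_eq_relations(8)[OF u False] r g]
    by (simp add: sandwich_linear)
  also have "\<dots> \<doteq> (\<Sum>e\<in>out_arcs G (fst d). word (real_word d @ [Arrow e, Vertex (head G e), Ghost e] @ ?g))"
  proof (rule leavitt_eq_sum)
    fix e assume "e \<in> out_arcs G (fst d)"
    then have e: "e \<in> arcs G" by simp
    show "word (real_word d @ [Arrow e, Ghost e] @ ?g)
        \<doteq> (word (real_word d @ [Arrow e, Vertex (head G e), Ghost e] @ ?g) :: _ \<Rightarrow>\<^sub>0 'k)"
      using leavitt_eq_sandwich[OF leavitt_eq_sym[OF leavitt_eq_relations(5)[OF e]], of "real_word d @ [Arrow e]" ?g]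
        r g e by simp
  qed
  also have "\<dots> = (\<Sum>c\<in>extensions G d. word (real_word c @ path_word c))"
    using False by (simp add: extensions_def sum.reindex inj_on_def real_word_def path_word_def)
  finally show ?thesis
    by (simp add: path_word_def)
qed

lemma unit_expansion:
  "word [] \<doteq> (\<Sum>d\<in>level G n. word (real_word d @ path_word d) :: ('a, 'b) leavitt_gen list \<Rightarrow>\<^sub>0 'k::field)"
proof (induction n)
  case 0
  have "(\<Sum>d\<in>level G 0. word (real_word d @ path_word d)) = (\<Sum>v\<in>verts G. word [Vertex v] :: _ \<Rightarrow>\<^sub>0 'k)"
    by (simp add: sum.reindex inj_on_def real_word_def path_word_def)
  then show ?case
    using leavitt_eq_sym[OF leavitt_eq_relations(2)] by simp
next
  case (Suc n)
  note Suc
  also have "(\<Sum>d\<in>level G n. word (real_word d @ path_word d) :: _ \<Rightarrow>\<^sub>0 'k)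
      \<doteq> (\<Sum>d\<in>level G n. \<Sum>c\<in>extensions G d. word (real_word c @ path_word c))"
    by (intro leavitt_eq_sum word_extension level_in_paths)
  also have "\<dots> = (\<Sum>c\<in>level G (Suc n). word (real_word c @ path_word c))"
    unfolding level.simps
    by (intro sum.UNION_disjoint[symmetric] ballI impI finite_level finite_extensions disjoint_extensions)
  finally show ?case .
qed

text \<open>The decomposition of the unit is multiplied by \<open>w\<close> from the right, letter
  by letter. Letters are peeled off the end of \<open>w\<close> because the last letter acts last on
  the ghost path.\<close>

lemma word_expansion:
  assumes "w \<in> lists (leavitt_gens G)" "length w \<le> n"
  shows "word w \<doteq> (\<Sum>d\<in>level G n. sandwich (real_word d)
    (ghost_word_map (basis_vector (ghost_act G w d) :: ('a, 'b) path \<Rightarrow>\<^sub>0 'k::field)) [])"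
  using assms
proof (induction w rule: rev_induct)
  case Nil
  then show ?case
    using unit_expansion by simp
next
  case (snoc g w)
  then have g: "g \<in> leavitt_gens G" and w: "w \<in> lists (leavitt_gens G)" "length w < n"
    by auto
  let ?T = "\<lambda>d. ghost_word_map (basis_vector (ghost_act G w d) :: ('a, 'b) path \<Rightarrow>\<^sub>0 'k)"
  have "word (w @ [g]) \<doteq> (\<Sum>d\<in>level G n. sandwich [] (sandwich (real_word d) (?T d) []) [g])"
    using leavitt_eq_sandwich[OF snoc.IH, of "[]" "[g]"] w g by (simp add: sandwich_linear)
  also have "\<dots> \<doteq> (\<Sum>d\<in>level G n. sandwich (real_word d)
      (ghost_word_map (basis_vector (ghost_act G (w @ [g]) d))) [])"
  proof (rule leavitt_eq_sum)
    fix d assume d: "d \<in> level G n"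
    show "sandwich [] (sandwich (real_word d) (?T d) []) [g]
        \<doteq> sandwich (real_word d) (ghost_word_map (basis_vector (ghost_act G (w @ [g]) d))) []"
    proof (cases "ghost_act G w d")
      case None
      then show ?thesis by (simp add: ghost_act_append)
    next
      case (Some d')
      \<comment> \<open>The word \<open>w\<close> uses up at most \<open>length w < n\<close> of the
        depth \<open>n\<close>, which leaves the depth 1 required for the letter
        \<open>g\<close>.\<close>
      have "d \<in> deep G (length w + 1)"
        using level_subset[OF d] w by (auto intro: deep_mono)
      then have d': "d' \<in> deep G 1"
        using ghost_act_deep[OF Some] w by simp
      have "ghost_act G (w @ [g]) d = ghost_step G g d'"
        using Some by (cases "ghost_step G g d'") (simp_all add: ghost_act_append)
      then show ?thesis
        using leavitt_eq_sandwich[OF path_word_step[OF d' g] real_word_in_lists[OF level_in_paths[OF d]], of "[]"]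
          Some by simp
    qed
  qed
  finally show ?case .
qed

lemma expansion:
  assumes "Poly_Mapping.keys f \<subseteq> lists (leavitt_gens G)" "\<forall>w\<in>Poly_Mapping.keys f. length w \<le> n"
  shows "f \<doteq> (\<Sum>d\<in>level G n. word_mult (word (real_word d)) (ghost_word_map (reduce G d f)))"
proof -
  have "lin word f \<doteq> lin (\<lambda>w. \<Sum>d\<in>level G n. sandwich (real_word d)
      (ghost_word_map (basis_vector (ghost_act G w d))) []) f"
    using assms by (intro leavitt_eq_lin word_expansion) auto
  also have "\<dots> = (\<Sum>d\<in>level G n. word_mult (word (real_word d)) (ghost_word_map (reduce G d f)))"
    by (simp add: lin_fun_sum sandwich_def ghost_word_map_def reduce_def lin_lin bilin_def)
  finally show ?thesis
    by simp
qed

section \<open>Compatibility with multiplication by ghost paths\<close>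

lemma reduce_ghost_word_map:
  assumes "Poly_Mapping.keys f \<subseteq> lists (leavitt_gens G)" "d \<in> paths H" "Poly_Mapping.keys a \<subseteq> paths H"
  shows "reduce G d (word_mult f (ghost_word_map a)) = bilin (path_comp H) (reduce G d f) a"
proof -
  \<comment> \<open>Vertices and ghosts remove no arrow, so this holds at every depth.\<close>
  have "reduce G d' (ghost_word_map a) = lin (path_comp H d') a" for d'
  proof -
    have "lin (\<lambda>x. basis_vector (ghost_act G (path_word x) d')) a = lin (path_comp H d') a"
      using assms(3) by (intro lin_cong ghost_act_path_word) auto
    then show ?thesis
      by (simp add: reduce_def ghost_word_map_def lin_lin)
  qed
  then show ?thesis
    unfolding reduce_word_mult bilin_def[of "path_comp H"] by simp
qed

text \<open>A product of two path words has the vertex letter of the second path in its middle. It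
  is absorbed if the paths compose and kills the word otherwise, as in
  \<open>path_comp\<close>.\<close>

lemma ghost_word_map_mult:
  assumes "Poly_Mapping.keys a \<subseteq> paths H" "Poly_Mapping.keys b \<subseteq> paths H"
  shows "ghost_word_map (bilin (path_comp H) a b) \<doteq> word_mult (ghost_word_map a) (ghost_word_map b)"
proof -
  have comp: "ghost_word_map (path_comp H x y :: ('a, 'b) path \<Rightarrow>\<^sub>0 'c) \<doteq> word (path_word x @ path_word y)"
    if "x \<in> paths H" "y \<in> paths H" for x y
  proof -
    have y: "fst y \<in> verts G" "map Ghost (snd y) \<in> lists (leavitt_gens G)"
      using ghost_path_in_lists(1)[OF that(2)] H.fst_in_verts[OF that(2)] by auto
    show ?thesis
      using leavitt_eq_sym[OF leavitt_eq_sandwich[OF path_word_vertex[OF that(1) y(1)], of "[]" "map Ghost (snd y)"]] y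
      by (auto simp: path_comp_def path_word_def)
  qed
  have "lin (\<lambda>x. lin (\<lambda>y. ghost_word_map (path_comp H x y)) b) a
      \<doteq> lin (\<lambda>x. lin (\<lambda>y. word (path_word x @ path_word y)) b) a"
    using assms by (intro leavitt_eq_lin comp) auto
  then show ?thesis
    by (simp add: bilin_def ghost_word_map_def lin_lin)
qed

lemma ghost_word_map_one:
  "ghost_word_map (\<Sum>v\<in>verts G. Poly_Mapping.single (v, []) 1) \<doteq> word []"
  using leavitt_eq_relations(2) by (simp add: ghost_word_map_def lin_sum path_word_def)

lemma ghost_word_map_in_A:
  "Poly_Mapping.keys a \<subseteq> paths H \<Longrightarrow> ghost_word_map a \<in> carrier A"
  unfolding ghost_word_map_def A_simps using path_word_in_lists
  by (intro CollectI subset_trans[OF keys_lin]) fastforce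

section \<open>Passage to the quotient\<close>

definition coset ::
  "(('a, 'b) leavitt_gen list \<Rightarrow>\<^sub>0 'k::field) \<Rightarrow> (('a, 'b) leavitt_gen list \<Rightarrow>\<^sub>0 'k) set"
  where "coset f = I +>\<^bsub>A\<^esub> f"

text \<open>Coordinates are read off from one chosen representative; a different choice changes them
  on finitely many levels at most.\<close>

definition representative ::
  "(('a, 'b) leavitt_gen list \<Rightarrow>\<^sub>0 'k::field) set \<Rightarrow> (('a, 'b) leavitt_gen list \<Rightarrow>\<^sub>0 'k)"
  where "representative x = (SOME f. f \<in> carrier A \<and> coset f = x)"

lemma ring_leavitt: "ring (leavitt_path_algebra G)"
  unfolding leavitt_path_algebra_def by (rule ideal.quotient_is_ring[OF ideal_I])

lemma coset_ring_hom: "coset \<in> ring_hom A (leavitt_path_algebra G)"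
  using ideal.rcos_ring_hom[OF ideal_I] unfolding leavitt_path_algebra_def
  by (simp add: coset_def[abs_def])

lemma coset_closed: "f \<in> carrier A \<Longrightarrow> coset f \<in> carrier (leavitt_path_algebra G)"
  by (rule ring_hom_closed[OF coset_ring_hom])

lemma coset_mult:
  "\<lbrakk>f \<in> carrier A; g \<in> carrier A\<rbrakk> \<Longrightarrow>
    coset f \<otimes>\<^bsub>leavitt_path_algebra G\<^esub> coset g = coset (word_mult f g)"
  using ring_hom_mult[OF coset_ring_hom, of f g] by (simp add: A_simps)

lemma coset_add:
  "\<lbrakk>f \<in> carrier A; g \<in> carrier A\<rbrakk> \<Longrightarrow>
    coset f \<oplus>\<^bsub>leavitt_path_algebra G\<^esub> coset g = coset (f + g)"
  using ring_hom_add[OF coset_ring_hom, of f g] by (simp add: A_simps)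

lemma coset_eq_iff:
  assumes "f \<in> carrier A" "g \<in> carrier A"
  shows "coset f = coset g \<longleftrightarrow> f \<doteq> g"
  using ring.quotient_eq_iff_same_a_r_cos[OF ring_A ideal_I assms] assms
  by (simp add: coset_def leavitt_eq_def a_minus_def a_inv_A A_simps(5))

lemma representative:
  assumes "x \<in> carrier (leavitt_path_algebra G)"
  shows "representative x \<in> carrier A" "coset (representative x) = x"
proof -
  have "\<exists>f. f \<in> carrier A \<and> coset f = x"
    using assms unfolding leavitt_path_algebra_def FactRing_def A_RCOSETS_def' coset_def by auto
  from someI_ex[OF this] show "representative x \<in> carrier A" "coset (representative x) = x"
    unfolding representative_def by blast+
qed

lemma ghost_embedding_eq: "ghost_embedding G a = coset (ghost_word_map a)"
  by (simp add: ghost_embedding_def coset_def ghost_word_map_def lin_def)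

lemma A_closed:
  "\<lbrakk>f \<in> carrier A; g \<in> carrier A\<rbrakk> \<Longrightarrow> word_mult f g \<in> carrier A"
  "\<lbrakk>f \<in> carrier A; g \<in> carrier A\<rbrakk> \<Longrightarrow> f + g \<in> carrier A"
  using ring.ring_simprules(1,5)[OF ring_A, of f g] by (simp_all add: A_simps(2,5))

lemma ghost_embedding_ring_hom:
  "ghost_embedding G \<in> ring_hom (path_algebra H :: (('a, 'b) path \<Rightarrow>\<^sub>0 'k::field) ring) (leavitt_path_algebra G)"
proof (rule ring_hom_memI)
  let ?P = "path_algebra H :: (('a, 'b) path \<Rightarrow>\<^sub>0 'k) ring"
  have P: "carrier ?P = {f. Poly_Mapping.keys f \<subseteq> paths H}" "x \<otimes>\<^bsub>?P\<^esub> y = bilin (path_comp H) x y"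
    "x \<oplus>\<^bsub>?P\<^esub> y = x + y" "\<one>\<^bsub>?P\<^esub> = (\<Sum>v\<in>verts G. Poly_Mapping.single (v, []) 1)" for x y
    by (simp_all add: path_algebra_eq)
  interpret P: ring ?P by (rule H.ring_path_algebra)
  fix a b :: "('a, 'b) path \<Rightarrow>\<^sub>0 'k" assume a: "a \<in> carrier ?P"
  show "ghost_embedding G a \<in> carrier (leavitt_path_algebra G)"
    using a unfolding ghost_embedding_eq by (intro coset_closed ghost_word_map_in_A) (simp add: P)
  assume b: "b \<in> carrier ?P"
  have gA: "ghost_word_map a \<in> carrier A" "ghost_word_map b \<in> carrier A"
    "ghost_word_map (a \<otimes>\<^bsub>?P\<^esub> b) \<in> carrier A"
    using a b P.m_closed[OF a b] by (auto intro!: ghost_word_map_in_A simp: P(1))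
  show "ghost_embedding G (a \<otimes>\<^bsub>?P\<^esub> b)
      = ghost_embedding G a \<otimes>\<^bsub>leavitt_path_algebra G\<^esub> ghost_embedding G b"
    unfolding ghost_embedding_eq coset_mult[OF gA(1,2)] coset_eq_iff[OF gA(3) A_closed(1)[OF gA(1,2)]]
    unfolding P(2)
    using a b by (intro ghost_word_map_mult) (simp_all add: P(1))
  show "ghost_embedding G (a \<oplus>\<^bsub>?P\<^esub> b)
      = ghost_embedding G a \<oplus>\<^bsub>leavitt_path_algebra G\<^esub> ghost_embedding G b"
    unfolding ghost_embedding_eq coset_add[OF gA(1,2)] P(3) by (simp add: ghost_word_map_def lin_add)
next
  let ?P = "path_algebra H :: (('a, 'b) path \<Rightarrow>\<^sub>0 'k) ring"
  interpret P: ring ?P by (rule H.ring_path_algebra)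
  have "ghost_word_map \<one>\<^bsub>?P\<^esub> \<in> carrier A"
    using P.one_closed by (intro ghost_word_map_in_A) (simp add: path_algebra_eq)
  then have "coset (ghost_word_map \<one>\<^bsub>?P\<^esub>) = coset (word [])"
    by (subst coset_eq_iff[OF _ word_in_A[OF lists.Nil]]) (simp_all add: path_algebra_eq ghost_word_map_one)
  then show "ghost_embedding G \<one>\<^bsub>?P\<^esub> = \<one>\<^bsub>leavitt_path_algebra G\<^esub>"
    using ring_hom_one[OF coset_ring_hom] by (simp only: ghost_embedding_eq A_simps(3))
qed

lemma leavitt_right_module_simps:
  "carrier (leavitt_right_module G) = carrier (leavitt_path_algebra G)"
  "x \<oplus>\<^bsub>leavitt_right_module G\<^esub> y = x \<oplus>\<^bsub>leavitt_path_algebra G\<^esub> y"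
  "a \<odot>\<^bsub>leavitt_right_module G\<^esub> x = x \<otimes>\<^bsub>leavitt_path_algebra G\<^esub> ghost_embedding G a"
  "\<zero>\<^bsub>leavitt_right_module G\<^esub> = \<zero>\<^bsub>leavitt_path_algebra G\<^esub>"
  by (simp_all add: leavitt_right_module_def ring.defs)

text \<open>L(E) as a right module over itself, with scalars restricted along the ring homomorphism
  \<open>ghost_embedding\<close>.\<close>

lemma right_module_leavitt:
  "right_module (path_algebra H) (leavitt_right_module G ::
    (('a, 'b) path \<Rightarrow>\<^sub>0 'k::field, (('a, 'b) leavitt_gen list \<Rightarrow>\<^sub>0 'k) set) module)"
proof -
  let ?P = "path_algebra H :: (('a, 'b) path \<Rightarrow>\<^sub>0 'k) ring"
  let ?L = "leavitt_path_algebra G :: (('a, 'b) leavitt_gen list \<Rightarrow>\<^sub>0 'k) set ring"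
  interpret P: ring ?P by (rule H.ring_path_algebra)
  interpret L: ring ?L by (rule ring_leavitt)
  note hom = ring_hom_closed[OF ghost_embedding_ring_hom] ring_hom_mult[OF ghost_embedding_ring_hom]
    ring_hom_add[OF ghost_embedding_ring_hom] ring_hom_one[OF ghost_embedding_ring_hom]
  have "abelian_group (leavitt_right_module G :: (('a, 'b) path \<Rightarrow>\<^sub>0 'k, _) module)"
    by (rule abelian_groupI) (auto simp: leavitt_right_module_simps L.a_ac intro: L.l_neg)
  then show ?thesis
    unfolding right_module_def right_module_axioms_def leavitt_right_module_simps
    by (simp add: P.ring_axioms hom L.l_distr L.r_distr L.m_assoc)
qed

lemma finsum_leavitt_right_module:
  fixes g :: "'i \<Rightarrow> (('a, 'b) leavitt_gen list \<Rightarrow>\<^sub>0 'k::field) set"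
  assumes "finite S" "g \<in> S \<rightarrow> carrier (leavitt_path_algebra G)"
  shows "finsum (leavitt_right_module G) g S = finsum (leavitt_path_algebra G) g S"
  using assms
proof (induction S)
  case empty
  interpret L: ring "leavitt_path_algebra G :: (('a, 'b) leavitt_gen list \<Rightarrow>\<^sub>0 'k) set ring"
    by (rule ring_leavitt)
  interpret M: right_module "path_algebra H :: (('a, 'b) path \<Rightarrow>\<^sub>0 'k) ring" "leavitt_right_module G"
    by (rule right_module_leavitt)
  show ?case
    by (simp add: leavitt_right_module_simps)
next
  case (insert i S)
  interpret L: ring "leavitt_path_algebra G :: (('a, 'b) leavitt_gen list \<Rightarrow>\<^sub>0 'k) set ring"
    by (rule ring_leavitt)
  interpret M: right_module "path_algebra H :: (('a, 'b) path \<Rightarrow>\<^sub>0 'k) ring" "leavitt_right_module G"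
    by (rule right_module_leavitt)
  show ?case
    using insert by (simp add: L.finsum_insert M.finsum_insert leavitt_right_module_simps Pi_iff)
qed

lemma coset_sum:
  assumes "finite S" "\<And>i. i \<in> S \<Longrightarrow> f i \<in> carrier A"
  shows "(\<Oplus>\<^bsub>leavitt_path_algebra G\<^esub>i\<in>S. coset (f i)) = coset (\<Sum>i\<in>S. f i)
    \<and> (\<Sum>i\<in>S. f i) \<in> carrier A"
  using assms
proof (induction S)
  case empty
  interpret ring_hom_ring A "leavitt_path_algebra G" coset
    by (intro ring_hom_ringI2 ring_A ring_leavitt coset_ring_hom)
  show ?case
    using hom_zero[symmetric] by (simp add: A_simps)
next
  case (insert i S)
  interpret L: ring "leavitt_path_algebra G" by (rule ring_leavitt)
  have "coset \<circ> f \<in> insert i S \<rightarrow> carrier (leavitt_path_algebra G)"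
    using insert.prems coset_closed by auto
  then show ?case
    using insert by (simp add: L.finsum_insert coset_closed coset_add A_closed Pi_iff)
qed

text \<open>The generators are the paths \<gamma> and the coordinates are x \<mapsto> \<gamma>^* x,
  both indexed by the reversed path. Representatives of sums and products are chosen independently
  of those of the terms, so the laws hold only eventually.\<close>

lemma eventual_dual_basis_leavitt:
  "eventual_dual_basis (path_algebra H)
    (leavitt_right_module G :: (('a, 'b) path \<Rightarrow>\<^sub>0 'k::field, (('a, 'b) leavitt_gen list \<Rightarrow>\<^sub>0 'k) set) module)
    sequentially (level G) (\<lambda>d. coset (word (real_word d))) (\<lambda>d x. reduce G d (representative x))"
proof -
  let ?P = "path_algebra H :: (('a, 'b) path \<Rightarrow>\<^sub>0 'k) ring"
  let ?L = "leavitt_path_algebra G :: (('a, 'b) leavitt_gen list \<Rightarrow>\<^sub>0 'k) set ring"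
  let ?M = "leavitt_right_module G :: (('a, 'b) path \<Rightarrow>\<^sub>0 'k, (('a, 'b) leavitt_gen list \<Rightarrow>\<^sub>0 'k) set) module"
  interpret L: ring ?L by (rule ring_leavitt)
  interpret M: right_module ?P ?M by (rule right_module_leavitt)
  have P: "carrier ?P = {f. Poly_Mapping.keys f \<subseteq> paths H}" "x \<otimes>\<^bsub>?P\<^esub> y = bilin (path_comp H) x y"
    "x \<oplus>\<^bsub>?P\<^esub> y = x + y" for x y
    by (simp_all add: path_algebra_eq)
  \<comment> \<open>The difference lies in the ideal and is killed beyond some depth, and all paths
    of level \<open>n\<close> have depth \<open>n\<close>.\<close>
  have reduce_cong: "\<forall>\<^sub>F n in sequentially. \<forall>d\<in>level G n. reduce G d f = reduce G d g"
    if "f \<doteq> g" for f g :: "('a, 'b) leavitt_gen list \<Rightarrow>\<^sub>0 'k"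
  proof -
    from reduce_I[OF that[unfolded leavitt_eq_def]]
    obtain n where n: "\<forall>d\<in>deep G n. reduce G d (f - g) = 0" ..
    have "\<forall>d\<in>level G m. reduce G d f = reduce G d g" if "n \<le> m" for m
      using n level_subset deep_mono[OF _ that] by (fastforce simp: reduce_linear)
    then show ?thesis
      by (auto simp: eventually_sequentially)
  qed
  have rep: "representative z \<doteq> f" if "z = coset f" "f \<in> carrier A"
    for z and f :: "('a, 'b) leavitt_gen list \<Rightarrow>\<^sub>0 'k"
    using that representative[OF coset_closed[OF that(2)]] coset_eq_iff by metis
  show ?thesis
  proof
    show "sequentially \<noteq> bot"
      by simp
    show "finite (level G n)" for n
      by (rule finite_level)
    show "coset (word (real_word d)) \<in> carrier ?M" if "d \<in> level G n" for d n
      using real_word_in_lists[OF level_in_paths[OF that]]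
      by (simp only: leavitt_right_module_simps coset_closed word_in_A)
    show "reduce G d (representative x) \<in> carrier ?P" if "d \<in> level G n" "x \<in> carrier ?M" for d n x
      using keys_reduce[OF _ level_in_paths[OF that(1)]] representative(1)[of x] that(2)
      by (simp add: P(1) A_simps(1) leavitt_right_module_simps)
  next
    fix x y assume xy: "x \<in> carrier ?M" "y \<in> carrier ?M"
    then have r: "representative x \<in> carrier A" "representative y \<in> carrier A"
      "x = coset (representative x)" "y = coset (representative y)"
      by (simp_all add: representative leavitt_right_module_simps)
    have "x \<oplus>\<^bsub>?M\<^esub> y = coset (representative x + representative y)"
      using coset_add[OF r(1,2)] r(3,4) by (simp add: leavitt_right_module_simps)
    from reduce_cong[OF rep[OF this A_closed(2)[OF r(1,2)]]]
    show "\<forall>\<^sub>F n in sequentially. \<forall>d\<in>level G n. reduce G d (representative (x \<oplus>\<^bsub>?M\<^esub> y))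
        = reduce G d (representative x) \<oplus>\<^bsub>?P\<^esub> reduce G d (representative y)"
      by (simp add: reduce_linear P(3))
  next
    fix a x assume a: "a \<in> carrier ?P" and x: "x \<in> carrier ?M"
    then have r: "representative x \<in> carrier A" "x = coset (representative x)"
      by (simp_all add: representative leavitt_right_module_simps)
    have g: "ghost_word_map a \<in> carrier A" and ka: "Poly_Mapping.keys a \<subseteq> paths H"
      using a by (simp_all add: P(1) ghost_word_map_in_A)
    have "a \<odot>\<^bsub>?M\<^esub> x = coset (word_mult (representative x) (ghost_word_map a))"
      using coset_mult[OF r(1) g] r(2) by (simp add: leavitt_right_module_simps ghost_embedding_eq)
    from reduce_cong[OF rep[OF this A_closed(1)[OF r(1) g]]]
    show "\<forall>\<^sub>F n in sequentially. \<forall>d\<in>level G n. reduce G d (representative (a \<odot>\<^bsub>?M\<^esub> x))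
        = reduce G d (representative x) \<otimes>\<^bsub>?P\<^esub> a"
    proof eventually_elim
      case (elim n)
      then show ?case
        using r(1) by (simp add: reduce_ghost_word_map[OF _ level_in_paths ka] P(2) A_simps(1))
    qed
  next
    fix x assume "x \<in> carrier ?M"
    then have x: "x \<in> carrier ?L"
      by (simp add: leavitt_right_module_simps)
    define f where "f = representative x"
    have f: "f \<in> carrier A" "x = coset f"
      using representative[OF x] by (simp_all add: f_def)
    \<comment> \<open>Any bound on the word lengths of the representative is a level from which its
      expansion is valid.\<close>
    obtain m where m: "\<forall>w\<in>Poly_Mapping.keys f. length w \<le> m"
      using bounded_word_length by metis
    have "x = (\<Oplus>\<^bsub>?M\<^esub>d\<in>level G n. reduce G d f \<odot>\<^bsub>?M\<^esub> coset (word (real_word d)))" if "m \<le> n" for n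
    proof -
      let ?t = "\<lambda>d. word_mult (word (real_word d)) (ghost_word_map (reduce G d f))"
      have cl: "word (real_word d) \<in> carrier A" "ghost_word_map (reduce G d f) \<in> carrier A"
        if "d \<in> level G n" for d
      proof -
        show "word (real_word d) \<in> carrier A"
          by (intro word_in_A real_word_in_lists level_in_paths[OF that])
        show "ghost_word_map (reduce G d f) \<in> carrier A"
          using f(1) by (intro ghost_word_map_in_A keys_reduce level_in_paths[OF that]) (simp add: A_simps(1))
      qed
      have sum: "(\<Oplus>\<^bsub>?L\<^esub>d\<in>level G n. coset (?t d)) = coset (\<Sum>d\<in>level G n. ?t d)"
        "(\<Sum>d\<in>level G n. ?t d) \<in> carrier A"
        using coset_sum[OF finite_level, of n ?t] A_closed(1)[OF cl] by auto
      have "f \<doteq> (\<Sum>d\<in>level G n. ?t d)"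
        using f(1) m that by (intro expansion) (auto simp: A_simps(1))
      then have "x = (\<Oplus>\<^bsub>?L\<^esub>d\<in>level G n. coset (?t d))"
        using f sum by (simp add: coset_eq_iff)
      also have "\<dots> = (\<Oplus>\<^bsub>?M\<^esub>d\<in>level G n. coset (?t d))"
        using coset_closed[OF A_closed(1)[OF cl]] by (intro finsum_leavitt_right_module[symmetric] finite_level) auto
      also have "\<dots> = (\<Oplus>\<^bsub>?M\<^esub>d\<in>level G n. reduce G d f \<odot>\<^bsub>?M\<^esub> coset (word (real_word d)))"
        using coset_closed[OF A_closed(1)[OF cl]]
        by (intro M.finsum_cong') (auto simp: leavitt_right_module_simps ghost_embedding_eq coset_mult cl)
      finally show ?thesis .
    qed
    then show "\<forall>\<^sub>F n in sequentially.
        x = (\<Oplus>\<^bsub>?M\<^esub>d\<in>level G n. reduce G d (representative x) \<odot>\<^bsub>?M\<^esub> coset (word (real_word d)))"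
      unfolding f_def by (auto simp: eventually_sequentially)
  qed
qed

end

theorem proposition4p1:
  fixes E :: "('v, 'e) pre_digraph"
  assumes "fin_digraph E"
  shows "flat_right_module TYPE('m) TYPE('n)
    (path_algebra (inverse_quiver E) :: (('v, 'e) path \<Rightarrow>\<^sub>0 'k::field) ring)
    (leavitt_right_module E)"
  using eventual_dual_basis.flat[OF fin_digraph.eventual_dual_basis_leavitt[OF assms]] .

end
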